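(* Let $T$ be a finite tree with a chosen root vertex, and let $\mathcal{P}$ be a set of $n$ distinct vertices of $T$ (the parties) with $2\le n\le 3$. Then running the DODAG-X protocol (Steps 1--7 of the context) on $T$ with party set $\mathcal{P}$ always yields the parties entangled with each other and with no other node; that is, in the final graph the subgraph induced on $\mathcal{P}$ is connected, and no party is adjacent to a vertex outside $\mathcal{P}$.
   Context: Graphs are finite, simple and undirected; $N_v$ is the neighborhood of $v$ in the current graph ($v\notin N_v$). A graph $G=(V,E)$ represents the graph state $|G\rangle=\prod_{\{u,v\}\in E}CZ_{u,v}|+\rangle^{\otimes |V|}$; all operations are tracked on the graph only, ignoring outcome-dependent local Clifford byproducts. Graph operations. $G-v$ deletes $v$ and all incident edges. Local complementation: $\tau_v(G)=(V,\,E\,\Delta\,\{\{i,j\}: i,j\in N_v, i\ne j\})$. A $Z$-measurement is $Z[v]$: $G\mapsto G-v$. An $X$-measurement with basis $w\in N_v$ is $X[v,w]$: $G\mapsto \tau_w Z_v\tau_v\tau_w(G)$ (first $\tau_w$, then $\tau_v$, then deletion of $v$, then $\tau_w$). Two nodes are called entangled (connected) after some steps if they are adjacent in the current graph; a set of nodes is entangled with each other and with no other node if it induces a connected subgraph and no member has a neighbor outside the set. DODAG-X protocol. The initial graph is the rooted tree $T$ with root $r$. All paths below are paths of the tree $T$; $P_{u,v}$ denotes the unique path (vertex sequence/set) in $T$ from $u$ to $v$. Step 1. Select the party set $\mathcal{P}$. Step 2. For each party $i$ take $P_{i,r}$, ordered from $i$ to $r$. If vertices other than $r$ lie on $P_{i,r}$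 for all $i\in\mathcal{P}$, replace the root by the one of these farthest from $r$ (only a relabeling of the root; edges are unchanged). From now on $r$ is this new root. Step 3. For parties $i\neq j$, the intersection node $a_{i,j}=a_{j,i}$ is the vertex of $P_{i,r}\cap P_{j,r}$ farthest from $r$. Step 4. For each party $i\ne r$ let $a$ be its nearest intersection node, i.e. the vertex nearest to $i$ among the $a_{i,j}$ ($j\in\mathcal{P}\setminus\{i\}$) that are different from $i$. Perform $X[v,i]$ on each interior vertex $v$ of $P_{i,a}$, sequentially from $i$ towards $a$ (endpoints excluded). Parties that are not themselves intersection nodes are routed first. Step 5. (a) If there is only one intersection node (so it equals $r$), do nothing. (b) If some intersection node $a_{i,j}\ne r$ is itself a party, do nothing. (c) If some intersection node $a_{i,j}$ is neither the root nor a party, write $P_{a_{i,j},r}=(v_1=a_{i,j},\dots,v_m=r)$ and perform $X[v_s,v_{s-1}]$ for even $s$ in increasing order, with $v_s\notin\{a_{i,j},r\}$; if $m$ is even, add a final $X[v_{m-1},i]$, where $i$ is a party entangled with (adjacent to) $a_{i,j}$ after Step 4. For $n\le 3$ at most one intersection node differs from $r$, so these cases are exhaustive. Step 6. If $r\in\mathcal{P}$, do nothing. Otherwise perform $X[r,i]$ for any party $i$ currently adjacent to $r$ (in case (c) with $m$ even, the party $i$ used in Step 5 is such a party). Step 7. $Z$-measure every vertex that is not a party and is in the current neighborhood of some party. *)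

theory Defs
  imports "Graph_Theory.Graph_Theory"
begin

section \<open>Undirected graphs and trees\<close>

text \<open>
  A finite simple undirected graph is a \<open>pair_graph\<close>: finite, loop-free, and with a symmetric
  arc relation, an edge \<open>{u, v}\<close> being the pair of arcs \<open>(u, v)\<close> and \<open>(v, u)\<close>.
  Since running an edge back and forth is a library cycle of length two, the library's
  \<open>forest\<close> and \<open>tree\<close> do not express acyclicity of undirected graphs; the cycles of an
  undirected graph are the library cycles of length at least three.
\<close>

definition undirected_tree :: "'a pair_pre_digraph \<Rightarrow> bool" where
  "undirected_tree T \<longleftrightarrow> pair_graph T \<and> connected (with_proj T) \<and>
     \<not> (\<exists>c. pre_digraph.cycle (with_proj T) c \<and> 3 \<le> length c)"

definition tree_path :: "'a pair_pre_digraph \<Rightarrow> 'a \<Rightarrow> 'a \<Rightarrow> 'a list" where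
  "tree_path T u v = (THE p. vpath p (with_proj T) \<and> hd p = u \<and> last p = v)"

definition tree_dist :: "'a pair_pre_digraph \<Rightarrow> 'a \<Rightarrow> 'a \<Rightarrow> nat" where
  "tree_dist T u v = vwalk_length (tree_path T u v)"

definition nbhd :: "'a pair_pre_digraph \<Rightarrow> 'a \<Rightarrow> 'a set" where
  "nbhd G v = {u. (v, u) \<in> parcs G}"


section \<open>Graph operations\<close>

definition local_comp :: "'a \<Rightarrow> 'a pair_pre_digraph \<Rightarrow> 'a pair_pre_digraph" where
  "local_comp v G = \<lparr> pverts = pverts G,
     parcs = sym_diff (parcs G) {(i, j). i \<in> nbhd G v \<and> j \<in> nbhd G v \<and> i \<noteq> j} \<rparr>"

definition measZ :: "'a \<Rightarrow> 'a pair_pre_digraph \<Rightarrow> 'a pair_pre_digraph" where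
  "measZ v G = \<lparr> pverts = pverts G - {v}, parcs = {(x, y) \<in> parcs G. x \<noteq> v \<and> y \<noteq> v} \<rparr>"

text \<open>
  \<open>X[v,w]\<close> is only defined for \<open>w\<close> in the current neighbourhood of \<open>v\<close>; \<open>None\<close> stands for an
  attempt to carry out an undefined measurement.
\<close>

definition measX :: "'a \<Rightarrow> 'a \<Rightarrow> 'a pair_pre_digraph \<Rightarrow> 'a pair_pre_digraph option" where
  "measX v w G =
     (if w \<in> nbhd G v
      then Some (local_comp w (measZ v (local_comp v (local_comp w G))))
      else None)"

primrec measX_seq :: "('a \<times> 'a) list \<Rightarrow> 'a pair_pre_digraph \<Rightarrow> 'a pair_pre_digraph option" where
  "measX_seq [] G = Some G"
| "measX_seq (m # ms) G = Option.bind (measX (fst m) (snd m) G) (measX_seq ms)"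


section \<open>Nondeterministic executions\<close>

text \<open>
  Several steps leave a choice open (the order in which parties are routed, the measurement basis).
  A step maps the current graph to the set of the results of all possible choices; \<open>None\<close> is an
  execution that breaks down, because of an undefined measurement or because
  there is nothing to choose from.
\<close>

type_synonym 'a outcomes = "'a pair_pre_digraph option set"

definition choose_from :: "'b set \<Rightarrow> ('b \<Rightarrow> 'a outcomes) \<Rightarrow> 'a outcomes" where
  "choose_from A f = (if A = {} then {None} else (\<Union>x\<in>A. f x))"

definition and_then ::
    "'a outcomes \<Rightarrow> ('a pair_pre_digraph \<Rightarrow> 'a outcomes) \<Rightarrow> 'a outcomes" (infixl \<open>and'_then\<close> 60) where
  "R and_then f = (\<Union>x\<in>R. case x of None \<Rightarrow> {None} | Some G \<Rightarrow> f G)"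


section \<open>The DODAG-X protocol\<close>

text \<open>
  Except in \<open>new_root\<close> and \<open>dodag_x\<close>, \<open>r\<close> is the root after relabelling. \<open>T\<close> always is the initial
  tree, to which all paths and distances refer, whereas neighbourhoods are taken in the current
  graph \<open>G\<close>.
\<close>

definition new_root :: "'a pair_pre_digraph \<Rightarrow> 'a \<Rightarrow> 'a set \<Rightarrow> 'a" where
  "new_root T r P =
     (let C = (\<Inter>i\<in>P. set (tree_path T i r)) - {r}
      in if C = {} then r else arg_max_on (tree_dist T r) C)"

definition inter_node :: "'a pair_pre_digraph \<Rightarrow> 'a \<Rightarrow> 'a \<Rightarrow> 'a \<Rightarrow> 'a" where
  "inter_node T r i j =
     arg_max_on (tree_dist T r) (set (tree_path T i r) \<inter> set (tree_path T j r))"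

definition inter_nodes :: "'a pair_pre_digraph \<Rightarrow> 'a \<Rightarrow> 'a set \<Rightarrow> 'a set" where
  "inter_nodes T r P = {inter_node T r i j | i j. i \<in> P \<and> j \<in> P \<and> i \<noteq> j}"

definition nearest_inter_node :: "'a pair_pre_digraph \<Rightarrow> 'a \<Rightarrow> 'a set \<Rightarrow> 'a \<Rightarrow> 'a" where
  "nearest_inter_node T r P i =
     arg_min_on (tree_dist T i) ({inter_node T r i j | j. j \<in> P - {i}} - {i})"

definition route :: "'a pair_pre_digraph \<Rightarrow> 'a \<Rightarrow> 'a set \<Rightarrow> 'a \<Rightarrow> ('a \<times> 'a) list" where
  "route T r P i =
     map (\<lambda>v. (v, i)) (butlast (tl (tree_path T i (nearest_inter_node T r P i))))"

definition routing_orders :: "'a pair_pre_digraph \<Rightarrow> 'a \<Rightarrow> 'a set \<Rightarrow> 'a list set" where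
  "routing_orders T r P =
     {xs @ ys | xs ys.
        distinct xs \<and> set xs = P - {r} - inter_nodes T r P \<and>
        distinct ys \<and> set ys = (P - {r}) \<inter> inter_nodes T r P}"

definition step4 ::
    "'a pair_pre_digraph \<Rightarrow> 'a \<Rightarrow> 'a set \<Rightarrow> 'a pair_pre_digraph \<Rightarrow> 'a outcomes" where
  "step4 T r P G =
     {measX_seq (concat (map (route T r P) ps)) G | ps. ps \<in> routing_orders T r P}"

text \<open>
  The vertices \<open>v 1 = a, \<dots>, v m = r\<close> form the path from \<open>a\<close> to \<open>r\<close>. As \<open>v\<close> is
  injective on \<open>{1..m}\<close>, an even \<open>s\<close> with \<open>v s\<close> different from \<open>a\<close> and \<open>r\<close> is an even \<open>s\<close>
  with \<open>2 \<le> s < m\<close>. The argument \<open>G\<close> is the graph after Step 4.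
\<close>

definition step5c ::
    "'a pair_pre_digraph \<Rightarrow> 'a \<Rightarrow> 'a set \<Rightarrow> 'a \<Rightarrow> 'a pair_pre_digraph \<Rightarrow> 'a outcomes" where
  "step5c T r P a G =
     (let p = tree_path T a r;
          m = length p;
          v = (\<lambda>s. p ! (s - 1));
          ms = map (\<lambda>s. (v s, v (s - 1))) (filter even [2..<m])
      in if even m
         then choose_from {i \<in> P. i \<in> nbhd G a} (\<lambda>i. {measX_seq (ms @ [(v (m - 1), i)]) G})
         else {measX_seq ms G})"

definition step5 ::
    "'a pair_pre_digraph \<Rightarrow> 'a \<Rightarrow> 'a set \<Rightarrow> 'a pair_pre_digraph \<Rightarrow> 'a outcomes" where
  "step5 T r P G =
     (if card (inter_nodes T r P) = 1 then {Some G}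
      else if \<exists>a \<in> inter_nodes T r P. a \<noteq> r \<and> a \<in> P then {Some G}
      else choose_from {a \<in> inter_nodes T r P. a \<noteq> r \<and> a \<notin> P} (\<lambda>a. step5c T r P a G))"

definition step6 :: "'a \<Rightarrow> 'a set \<Rightarrow> 'a pair_pre_digraph \<Rightarrow> 'a outcomes" where
  "step6 r P G =
     (if r \<in> P then {Some G}
      else choose_from {i \<in> P. i \<in> nbhd G r} (\<lambda>i. {measX r i G}))"

definition step7 :: "'a set \<Rightarrow> 'a pair_pre_digraph \<Rightarrow> 'a outcomes" where
  "step7 P G =
     {Some (fold measZ vs G) | vs.
        distinct vs \<and> set vs = {v \<in> pverts G. v \<notin> P \<and> (\<exists>i\<in>P. v \<in> nbhd G i)}}"

definition dodag_x :: "'a pair_pre_digraph \<Rightarrow> 'a \<Rightarrow> 'a set \<Rightarrow> 'a outcomes" where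
  "dodag_x T r0 P =
     (let r = new_root T r0 P
      in step4 T r P T and_then step5 T r P and_then step6 r P and_then step7 P)"

definition entangled_exactly :: "'a pair_pre_digraph \<Rightarrow> 'a set \<Rightarrow> bool" where
  "entangled_exactly G P \<longleftrightarrow>
     P \<subseteq> pverts G \<and> connected (with_proj G \<restriction> P) \<and> (\<forall>i\<in>P. nbhd G i \<subseteq> P)"

end

theory Submission
  imports Defs
begin

text \<open>
  An X-measurement \<open>X[v,w]\<close> is a pivot on the edge \<open>vw\<close> followed by the deletion of \<open>v\<close>; its effect on
  the subgraph induced by a vertex set containing \<open>v\<close> and \<open>w\<close> depends on that subgraph only. Hence one
  may restrict attention to the union of the tree paths from the parties to the root, and shrink this
  set further as vertices become irrelevant. On it, routing a leaf party along its leg simply makes it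
  adjacent to the far end of the leg. The relabelling of the root ensures that no
  other vertex lies on all paths to it, so for three parties at least two of the three
  intersection nodes are the root, and only a star with centre \<open>r\<close> (which covers two parties), an
  intersection node that is a party, and a single non-party intersection node remain. Before Step 6 the
  parties and the root form a star around \<open>r\<close> or a path with \<open>r\<close> on it; in either case some party is
  adjacent to all others after Step 6, whatever its choice. Step 7 deletes the remaining neighbours and
  does not change the graph on the parties.
\<close>

section \<open>Paths in trees\<close>

text \<open>Vertices outside the observed set may be adjacent to anything, and their arcs are never
  computed. Every invariant therefore lists exact neighbourhoods inside the observed set,
  non-adjacency included, since a pivot toggles a pair according to which of its ends are adjacent
  to the two pivot vertices. The delicate point is a party that hangs on a leg while the leg is
  being contracted; such parties are kept in a separate set \<open>J\<close>, disjoint from the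
  observed set. If the intersection node is a party and is routed itself, the party below it
  switches between two attachment points with every measurement, so the parity of the leg decides
  between a path and a star. In Step 5(c) the two parties hanging on the intersection node are
  carried along two vertices at a time, and the parity of the path decides whether they reach the
  root or stop one vertex short of it, where the extra measurement takes over. The root may itself
  be a party, hence the recurring side condition \<open>k \<noteq> r\<close>.\<close>

lemma vwalk_arcs_closed_walk:
  "p \<noteq> [] \<Longrightarrow> pcas (hd p) (vwalk_arcs p) (last p) \<and> pawalk_verts (hd p) (vwalk_arcs p) = p"
proof (induction p rule: vwalk_arcs.induct)
qed auto

lemma vwalk_with_proj:
  "vwalk p (with_proj T) \<longleftrightarrow> set p \<subseteq> pverts T \<and> set (vwalk_arcs p) \<subseteq> parcs T \<and> p \<noteq> []"
  by (simp add: vwalk_def)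

locale utree =
  fixes T :: "'a pair_pre_digraph"
  assumes undirected_tree: "undirected_tree T"
begin

sublocale pair_graph T
  using undirected_tree by (simp add: undirected_tree_def)

lemma parcs_sym: "(x, y) \<in> parcs T \<Longrightarrow> (y, x) \<in> parcs T"
  using pair_sym_arcs by (auto simp: symmetric_def sym_def)

lemma parcs_irrefl: "(x, x) \<notin> parcs T"
  using pair_no_loops by fastforce

text \<open>Acyclicity of the tree speaks of cycles as arc lists, whereas tree paths are vertex
  lists. The closed walk \<open>u, w, u\<close> has \<open>length w + 1\<close> arcs, so two inner
  vertices are just what rules out running an edge back and forth.\<close>

lemma no_closed_walk:
  assumes "set (vwalk_arcs (u # w @ [u])) \<subseteq> parcs T" "distinct (u # w)" "2 \<le> length w"
  shows False
proof -
  let ?p = "u # w @ [u]"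
  have "pcas u (vwalk_arcs ?p) u" "pawalk_verts u (vwalk_arcs ?p) = ?p"
    using vwalk_arcs_closed_walk[of ?p] by auto
  moreover have "(u, hd (w @ [u])) \<in> parcs T"
    using assms(1) by simp
  then have "u \<in> pverts T" by (rule in_arcsD1)
  moreover have "length (vwalk_arcs ?p) = length w + 1"
    using vwalk_length_simp[of ?p] unfolding vwalk_length_def by simp
  ultimately have "cycle (vwalk_arcs ?p)"
    using assms unfolding cycle_def awalk_def by (intro exI[of _ u]) auto
  moreover have "3 \<le> length (vwalk_arcs ?p)"
    using \<open>length (vwalk_arcs ?p) = length w + 1\<close> assms(3) by linarith
  ultimately show False
    using undirected_tree by (auto simp: undirected_tree_def)
qed

lemma vwalk_rev: "vwalk p (with_proj T) \<Longrightarrow> vwalk (rev p) (with_proj T)"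
  using parcs_sym by (auto simp: vwalk_with_proj set_vwalk_arcs_rev)

text \<open>The induction strips off a common first vertex. If the second vertices differ, following
  \<open>p\<close> to its first vertex on \<open>q'\<close> and returning along \<open>q'\<close>
  closes a cycle.\<close>

lemma vpath_unique:
  "\<lbrakk>vpath p (with_proj T); vpath q (with_proj T); hd p = hd q; last p = last q\<rbrakk> \<Longrightarrow> p = q"
proof (induction p arbitrary: q)
  case Nil
  then show ?case by (auto simp: vpath_def vwalk_def)
next
  case (Cons u p)
  then obtain q' where q: "q = u # q'"
    by (cases q) (auto simp: vpath_def vwalk_def)
  show ?case
  proof (cases "p = [] \<or> q' = []")
    case True
    with Cons.prems q show ?thesis
      by (auto simp: vpath_def split: if_splits)
  next
    case False
    then have ne: "p \<noteq> []" "q' \<noteq> []" by auto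
    have vp: "vpath p (with_proj T)" "vpath q' (with_proj T)" "u \<notin> set p" "u \<notin> set q'"
      and ar: "(u, hd p) \<in> parcs T" "(u, hd q') \<in> parcs T"
      using Cons.prems q ne by (auto simp: vpath_def vwalk_with_proj)
    have l: "last p = last q'"
      using Cons.prems q ne by auto
    show ?thesis
    proof (cases "hd p = hd q'")
      case True
      with Cons.IH[OF vp(1,2) True l] q show ?thesis by simp
    next
      case neq: False
      have "\<exists>z\<in>set p. z \<in> set q'"
        using last_in_set[OF ne(1)] last_in_set[OF ne(2)] l by metis
      then obtain p1 z p2 where p: "p = p1 @ z # p2" "z \<in> set q'" "\<forall>y\<in>set p1. y \<notin> set q'"
        using split_list_first_prop[of p "\<lambda>z. z \<in> set q'"] by blast
      then obtain q1 q2 where q': "q' = q1 @ z # q2"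
        by (meson split_list)
      \<comment> \<open>These are the inner vertices of the cycle through \<open>u\<close>. They are
        distinct because \<open>z\<close> is the first vertex of \<open>p\<close> on
        \<open>q'\<close>, which keeps \<open>p1\<close> and \<open>q1\<close> disjoint.\<close>
      let ?w = "p1 @ z # rev q1"
      have "vwalk (u # p1 @ [z]) (with_proj T)" "vwalk (u # q1 @ [z]) (with_proj T)"
        using Cons.prems(1,2) vwalkI_append_l[of "u # p1 @ [z]" p2] vwalkI_append_l[of "u # q1 @ [z]" q2]
        unfolding q q' p vpath_def by auto
      then have "set (vwalk_arcs (u # p1 @ [z])) \<subseteq> parcs T"
        "set (vwalk_arcs (rev (u # q1 @ [z]))) \<subseteq> parcs T"
        using vwalk_rev[of "u # q1 @ [z]"] unfolding vwalk_with_proj by blast+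
      moreover have "vwalk_arcs (u # ?w @ [u]) = vwalk_arcs (u # p1 @ [z]) @ vwalk_arcs (rev (u # q1 @ [z]))"
        using vwalk_arcs_append[of "u # p1 @ [z]" "rev q1 @ [u]"]
          vwalk_arcs_append[of "[z]" "rev q1 @ [u]"] by (simp del: vwalk_arcs.simps(3) vwalk_arcs_Cons)
      ultimately have "set (vwalk_arcs (u # ?w @ [u])) \<subseteq> parcs T"
        by (simp only: set_append Un_least)
      moreover have "distinct (u # ?w)"
        using vp p q' by (auto simp: vpath_def)
      \<comment> \<open>\<open>p1\<close> and \<open>q1\<close> are not both empty, since otherwise
        both paths would continue with \<open>z\<close>.\<close>
      moreover have "2 \<le> length ?w"
        using neq p q' by (cases p1; cases q1) auto
      ultimately show ?thesis
        using no_closed_walk[of u ?w] by simp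
    qed
  qed
qed

lemma ex_vpath:
  assumes "u \<in> pverts T" "v \<in> pverts T"
  shows "\<exists>p. vpath p (with_proj T) \<and> hd p = u \<and> last p = v"
proof -
  have "strongly_connected (with_proj T)"
    using undirected_tree pair_sym_arcs
    by (intro symmetric_connected_imp_strongly_connected) (simp_all add: undirected_tree_def)
  then have "u \<rightarrow>\<^sup>*\<^bsub>with_proj T\<^esub> v"
    using assms by (auto simp: strongly_connected_def)
  then show ?thesis
    using reachable_vpath_conv by auto
qed

lemma tree_path:
  assumes "u \<in> pverts T" "v \<in> pverts T"
  shows "vpath (tree_path T u v) (with_proj T)" "hd (tree_path T u v) = u" "last (tree_path T u v) = v"
proof -
  have "\<exists>!p. vpath p (with_proj T) \<and> hd p = u \<and> last p = v"
    using ex_vpath[OF assms] vpath_unique by metis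
  from theI'[OF this] show "vpath (tree_path T u v) (with_proj T)" "hd (tree_path T u v) = u"
    "last (tree_path T u v) = v"
    by (auto simp: tree_path_def)
qed

lemma tree_path_eqI:
  assumes "vpath p (with_proj T)"
  shows "tree_path T (hd p) (last p) = p"
proof -
  have "set p \<subseteq> pverts T" "p \<noteq> []" using assms by (auto simp: vpath_def vwalk_def)
  then have "hd p \<in> pverts T" "last p \<in> pverts T" by auto
  from tree_path[OF this] assms show ?thesis by (intro vpath_unique) auto
qed

lemma tree_path_append:
  assumes "u \<in> pverts T" "v \<in> pverts T" "tree_path T u v = p @ x # q"
  shows "tree_path T u x = p @ [x]" "tree_path T x v = x # q"
proof -
  have vp: "vpath (p @ x # q) (with_proj T)" "hd (p @ x # q) = u" "last (p @ x # q) = v"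
    using tree_path[OF assms(1,2)] assms(3) by auto
  have "vwalk (p @ [x]) (with_proj T)" "vwalk (x # q) (with_proj T)"
    using vp(1) vwalkI_append_l[of "p @ [x]" q] vwalkI_append_r[of "x # q" p]
    unfolding vpath_def by auto
  then have "vpath (p @ [x]) (with_proj T)" "vpath (x # q) (with_proj T)"
    using vp(1) by (auto simp: vpath_def)
  from this[THEN tree_path_eqI] vp show "tree_path T u x = p @ [x]" "tree_path T x v = x # q"
    by (auto simp: hd_append split: if_splits)
qed

lemma tree_path_rev:
  "\<lbrakk>u \<in> pverts T; v \<in> pverts T\<rbrakk> \<Longrightarrow> tree_path T v u = rev (tree_path T u v)"
  using tree_path[of u v] tree_path_eqI[of "rev (tree_path T u v)"] vwalk_rev
  by (auto simp: vpath_def hd_rev last_rev)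

lemma tree_dist_length:
  "tree_dist T u v = length (tree_path T u v) - 1"
  by (simp add: tree_dist_def)

lemma tree_path_self: "u \<in> pverts T \<Longrightarrow> tree_path T u u = [u]"
  using tree_path_eqI[of "[u]"] vpath_self[of u "with_proj T"] by simp

end

section \<open>Rooted trees\<close>

text \<open>\<open>leg A S u q t\<close>: within the vertex set \<open>S\<close>, the path \<open>u, q, t\<close> is induced and is attached to the
  rest of \<open>S\<close> only at \<open>t\<close>.\<close>

primrec chain :: "'a rel \<Rightarrow> 'a set \<Rightarrow> 'a \<Rightarrow> 'a list \<Rightarrow> 'a \<Rightarrow> bool" where
  "chain A S u [] t \<longleftrightarrow> True"
| "chain A S u (v # vs) t \<longleftrightarrow>
     (\<forall>x\<in>S. (v, x) \<in> A \<longleftrightarrow> x = u \<or> x = hd (vs @ [t])) \<and> chain A S v vs t"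

definition leg :: "'a rel \<Rightarrow> 'a set \<Rightarrow> 'a \<Rightarrow> 'a list \<Rightarrow> 'a \<Rightarrow> bool" where
  "leg A S u q t \<longleftrightarrow> (\<forall>x\<in>S. (u, x) \<in> A \<longleftrightarrow> x = hd (q @ [t])) \<and> chain A S u q t"

text \<open>\<open>arg_max_on\<close> selects by choice; a strict maximum leaves it a single
  candidate.\<close>

lemma arg_max_on_eqI:
  fixes f :: "'a \<Rightarrow> nat"
  assumes "c \<in> S" "\<And>x. \<lbrakk>x \<in> S; x \<noteq> c\<rbrakk> \<Longrightarrow> f x < f c"
  shows "arg_max_on f S = c"
proof -
  have "is_arg_max f (\<lambda>x. x \<in> S) x \<longleftrightarrow> x = c" for x
    using assms by (auto simp: is_arg_max_def) (metis not_less_iff_gr_or_eq)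
  then show ?thesis by (simp add: arg_max_on_def arg_max_def)
qed

locale rooted_tree = utree +
  fixes r
  assumes root: "r \<in> pverts T"
begin

definition root_path where "root_path x = tree_path T x r"
text \<open>At \<open>r\<close> the value is \<open>hd []\<close>, hence the guards
  \<open>x \<noteq> r\<close> wherever parents occur.\<close>

definition parent where "parent x = hd (tl (root_path x))"

lemma root_path_root: "root_path r = [r]"
  using root by (simp add: root_path_def tree_path_self)

lemma root_path_props:
  assumes "x \<in> pverts T"
  shows "vpath (root_path x) (with_proj T)" "hd (root_path x) = x" "last (root_path x) = r" "root_path x \<noteq> []" "distinct (root_path x)"
    "set (root_path x) \<subseteq> pverts T"
  using tree_path[OF assms root] by (auto simp: root_path_def vpath_def vwalk_with_proj)

lemma root_path_eqI: "\<lbrakk>vpath p (with_proj T); last p = r\<rbrakk> \<Longrightarrow> root_path (hd p) = p"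
  using tree_path_eqI by (auto simp: root_path_def)

lemma self_in_root_path: "x \<in> pverts T \<Longrightarrow> x \<in> set (root_path x)"
  using root_path_props(2,4) list.set_sel(1) by metis

lemma root_in_root_path: "x \<in> pverts T \<Longrightarrow> r \<in> set (root_path x)"
  using root_path_props(3,4) last_in_set by metis

lemma root_path_suffix: "\<lbrakk>x \<in> pverts T; root_path x = p @ y # q\<rbrakk> \<Longrightarrow> root_path y = y # q"
  using tree_path_append(2)[OF _ root] by (simp add: root_path_def)

lemma in_root_path_split:
  assumes "x \<in> pverts T" "y \<in> set (root_path x)"
  obtains p where "root_path x = p @ root_path y" "tree_path T x y = p @ [y]"
proof -
  obtain p q where p: "root_path x = p @ y # q"
    using assms(2) by (meson split_list)
  with root_path_suffix[OF assms(1) p] tree_path_append(1)[OF assms(1) root p[unfolded root_path_def]] that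
  show thesis by simp
qed

lemma root_path_subset: "\<lbrakk>x \<in> pverts T; y \<in> set (root_path x)\<rbrakk> \<Longrightarrow> set (root_path y) \<subseteq> set (root_path x)"
  by (metis in_root_path_split set_append Un_upper2)

lemma in_root_path_verts: "\<lbrakk>x \<in> pverts T; y \<in> set (root_path x)\<rbrakk> \<Longrightarrow> y \<in> pverts T"
  using root_path_props(6) by blast

lemma root_path_step:
  assumes "x \<in> pverts T" "x \<noteq> r"
  shows "root_path x = x # root_path (parent x)" "parent x \<in> pverts T"
proof -
  obtain q where q: "root_path x = x # q"
    using root_path_props(2,4)[OF assms(1)] by (metis list.collapse)
  then have "q \<noteq> []"
    using root_path_props(3)[OF assms(1)] assms(2) by auto
  then obtain q' where q': "q = parent x # q'"
    using q by (auto simp: parent_def neq_Nil_conv)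
  then show "root_path x = x # root_path (parent x)"
    using q root_path_suffix[OF assms(1), of "[x]" "parent x" q'] by simp
  show "parent x \<in> pverts T"
    using root_path_props(6)[OF assms(1)] q q' by simp
qed

lemma root_path_conv_parent: "\<lbrakk>x \<in> pverts T; root_path x = x # root_path y; y \<in> pverts T\<rbrakk> \<Longrightarrow> parent x = y"
  using root_path_props(2,4) by (simp add: parent_def)

text \<open>One end of an edge is off the root path of the other end; prepending it to that path
  yields a path to \<open>r\<close>, which by uniqueness is its own root path.\<close>

lemma adj_iff:
  assumes "x \<in> pverts T" "y \<in> pverts T"
  shows "(x, y) \<in> parcs T \<longleftrightarrow> x \<noteq> r \<and> parent x = y \<or> y \<noteq> r \<and> parent y = x"
proof -
  have parent_adj: "(u, parent u) \<in> parcs T" if "u \<in> pverts T" "u \<noteq> r" for u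
    using root_path_props(1)[OF that(1)] root_path_step(1)[OF that] root_path_props(2,4)[OF root_path_step(2)[OF that]]
    by (auto simp: vpath_def vwalk_with_proj)
  have "x \<noteq> r \<and> parent x = y \<or> y \<noteq> r \<and> parent y = x" if xy: "(x, y) \<in> parcs T"
  proof -
    have ext: "v \<noteq> r \<and> parent v = u" if "(u, v) \<in> parcs T" "u \<in> pverts T" "v \<in> pverts T" "v \<notin> set (root_path u)" for u v
    proof -
      have "vpath (v # root_path u) (with_proj T)"
        using that root_path_props[OF that(2)] parcs_sym[OF that(1)] by (auto simp: vpath_def vwalk_with_proj)
      then have "root_path v = v # root_path u"
        using root_path_eqI[of "v # root_path u"] root_path_props[OF that(2)] by simp
      moreover have "v \<noteq> r" using that root_in_root_path by auto
      ultimately show ?thesis using root_path_conv_parent that by simp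
    qed
    show ?thesis
    proof (cases "y \<in> set (root_path x)")
      case True
      then obtain p where p: "root_path x = p @ root_path y" using in_root_path_split assms by metis
      \<comment> \<open>Otherwise each of the two root paths would be a suffix of the other, and
        they would coincide.\<close>
      have "x \<notin> set (root_path y)"
      proof
        assume "x \<in> set (root_path y)"
        then obtain q where q: "root_path y = q @ root_path x" using in_root_path_split assms by metis
        with p have "root_path y = root_path x" by simp
        then have "x = y" using root_path_props(2) assms by metis
        with xy parcs_irrefl show False by simp
      qed
      with ext[OF parcs_sym[OF xy]] assms show ?thesis by blast
    qed (use ext[OF xy] assms in blast)
  qed
  with parent_adj assms parcs_sym show ?thesis by blast
qed

lemma dist_root: "x \<in> pverts T \<Longrightarrow> tree_dist T r x = length (root_path x) - 1"
  using tree_path_rev[OF _ root] by (simp add: tree_dist_length root_path_def)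

text \<open>Both root paths are suffixes of one list, and a suffix is determined by its length:
  along a root path, depth identifies a vertex.\<close>

lemma root_path_eq_length:
  assumes "i \<in> pverts T" "x \<in> set (root_path i)" "y \<in> set (root_path i)" "length (root_path x) = length (root_path y)"
  shows "x = y"
proof -
  obtain p where p: "root_path i = p @ root_path x" using in_root_path_split assms by metis
  obtain q where q: "root_path i = q @ root_path y" using in_root_path_split assms by metis
  have "root_path x = root_path y" using p q assms(4) by (simp add: append_eq_append_conv)
  then show ?thesis using root_path_props(2) in_root_path_verts assms by metis
qed

lemma root_path_length_less:
  assumes "x \<in> pverts T" "y \<in> set (root_path x)" "y \<noteq> x"
  shows "length (root_path y) < length (root_path x)"
proof -
  obtain p where p: "root_path x = p @ root_path y" using in_root_path_split assms by metis
  then show ?thesis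
    using root_path_eq_length[OF assms(1,2) self_in_root_path[OF assms(1)]] assms(3) by (cases "p = []") auto
qed

text \<open>Two suffixes of one list are nested.\<close>

lemma root_path_chain:
  assumes "i \<in> pverts T" "x \<in> set (root_path i)" "y \<in> set (root_path i)"
  shows "x \<in> set (root_path y) \<or> y \<in> set (root_path x)"
proof -
  obtain p where p: "root_path i = p @ root_path x" using in_root_path_split assms by metis
  obtain q where q: "root_path i = q @ root_path y" using in_root_path_split assms by metis
  have v: "x \<in> pverts T" "y \<in> pverts T" using in_root_path_verts assms by auto
  have "p @ root_path x = q @ root_path y" using p q by simp
  then show ?thesis
    using self_in_root_path[OF v(1)] self_in_root_path[OF v(2)] unfolding append_eq_append_conv2
    by (metis Un_iff set_append)
qed

lemma inter_node_eqI:
  assumes "i \<in> pverts T" "j \<in> pverts T" "c \<in> pverts T"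
    and c: "set (root_path i) \<inter> set (root_path j) = set (root_path c)"
  shows "inter_node T r i j = c"
  unfolding inter_node_def root_path_def[symmetric] c
proof (rule arg_max_on_eqI)
  show "c \<in> set (root_path c)" using assms self_in_root_path by simp
next
  fix x assume x: "x \<in> set (root_path c)" "x \<noteq> c"
  then have "x \<in> pverts T" using assms in_root_path_verts by blast
  moreover have "length (root_path x) < length (root_path c)" using root_path_length_less x assms by blast
  moreover have "root_path x \<noteq> []" using root_path_props(4) calculation by blast
  ultimately show "tree_dist T r x < tree_dist T r c"
    using assms by (cases "root_path x") (auto simp: dist_root)
qed

text \<open>A common vertex of greatest depth will do: every other common vertex is comparable with
  it and, being no deeper, lies on its root path. This trades the extremal description of an
  intersection node for an equation between sets.\<close>

lemma ex_inter_node: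
  assumes "i \<in> pverts T" "j \<in> pverts T"
  shows "\<exists>c\<in>pverts T. set (root_path i) \<inter> set (root_path j) = set (root_path c)"
proof -
  let ?S = "set (root_path i) \<inter> set (root_path j)"
  have "?S \<noteq> {}" using root_in_root_path assms by auto
  then have "Max ((\<lambda>x. length (root_path x)) ` ?S) \<in> (\<lambda>x. length (root_path x)) ` ?S"
    by (intro Max_in) auto
  then obtain c where c: "c \<in> ?S" "length (root_path c) = Max ((\<lambda>x. length (root_path x)) ` ?S)"
    by (metis (no_types, lifting) imageE)
  then have c: "c \<in> ?S" "\<And>x. x \<in> ?S \<Longrightarrow> length (root_path x) \<le> length (root_path c)"
    by (auto intro!: Max_ge)
  have cv: "c \<in> pverts T" using c in_root_path_verts assms by blast
  have "?S \<subseteq> set (root_path c)"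
  proof
    fix x assume x: "x \<in> ?S"
    then have "x \<in> set (root_path c) \<or> c \<in> set (root_path x)" using root_path_chain assms c by blast
    moreover have "x = c" if "c \<in> set (root_path x)"
      using root_path_length_less[of x c] that c(2)[OF x] in_root_path_verts x assms by force
    ultimately show "x \<in> set (root_path c)" using self_in_root_path cv by blast
  qed
  moreover have "set (root_path c) \<subseteq> ?S" using root_path_subset assms c by blast
  ultimately show ?thesis using cv by blast
qed

section \<open>Legs in the initial tree\<close>

lemma parent_inj_on_root_path:
  assumes "i \<in> pverts T" "x \<in> set (root_path i)" "y \<in> set (root_path i)" "x \<noteq> r" "y \<noteq> r" "parent x = parent y"
  shows "x = y"
  using assms root_path_step(1)[of x] root_path_step(1)[of y] in_root_path_verts root_path_eq_length[of i x y] by simp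

text \<open>In the tree a vertex is adjacent to its parent and its children only. The last
  hypothesis keeps side branches out of \<open>S\<close>, and on one root path a vertex has a single
  child, so inside \<open>S\<close> only predecessor and successor remain.\<close>

lemma chain_tree:
  assumes "i \<in> pverts T" "u \<in> set (root_path i)" "root_path u = u # q @ root_path t" "t \<in> pverts T" "S \<subseteq> pverts T"
    and "\<And>x. \<lbrakk>x \<in> S; x \<noteq> r; parent x \<in> set q\<rbrakk> \<Longrightarrow> x \<in> set (root_path i)"
  shows "chain (parcs T) S u q t"
  using assms(2,3,6)
proof (induction q arbitrary: u)
  case (Cons v q)
  have u: "u \<in> pverts T" using Cons.prems assms(1) in_root_path_verts by blast
  have pav: "root_path v = v # q @ root_path t" using root_path_suffix[OF u, of "[u]"] Cons.prems by simp
  have v: "v \<in> set (root_path i)" using Cons.prems(1,2) root_path_subset[OF assms(1), of u] by auto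
  have vv: "v \<in> pverts T" using v assms(1) in_root_path_verts by blast
  have "u \<noteq> r" using Cons.prems(2) root_path_root root_path_props(4)[OF assms(4)] by auto
  have "v \<noteq> r" using pav root_path_root root_path_props(4)[OF assms(4)] by auto
  have "parent u = v" using root_path_step(1)[OF u \<open>u \<noteq> r\<close>] Cons.prems(2) root_path_conv_parent[OF u _ vv] pav by simp
  have "parent v = hd (q @ [t])"
    using pav root_path_props(2)[OF assms(4)] root_path_props(4)[OF assms(4)] by (cases q) (auto simp: parent_def)
  have "(v, x) \<in> parcs T \<longleftrightarrow> x = u \<or> x = hd (q @ [t])" if "x \<in> S" for x
  proof -
    have "x \<in> pverts T" using that assms(5) by blast
    moreover have "x = u" if "parent x = v" "x \<noteq> r"
      using parent_inj_on_root_path[OF assms(1) Cons.prems(3)[OF \<open>x \<in> S\<close>] Cons.prems(1)] that \<open>u \<noteq> r\<close> \<open>parent u = v\<close>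
      by simp
    ultimately show ?thesis
      using adj_iff[OF vv, of x] \<open>v \<noteq> r\<close> \<open>parent v = _\<close> \<open>parent u = v\<close> \<open>u \<noteq> r\<close> by auto
  qed
  with Cons.IH[OF v pav] Cons.prems(3) show ?case by simp
qed simp

text \<open>A root path contains the parent of each of its vertices other than \<open>r\<close>.
  Hence a child of a leg vertex on the root path of a party \<open>p\<close> puts the leg vertex on
  that path as well, and disjointness leaves only \<open>p = i\<close>.\<close>

lemma leg_tree:
  assumes "i \<in> P" "P \<subseteq> pverts T" "root_path i = i # q @ root_path t" "t \<in> pverts T"
    and "\<And>p. \<lbrakk>p \<in> P; p \<noteq> i\<rbrakk> \<Longrightarrow> set (i # q) \<inter> set (root_path p) = {}"
  shows "leg (parcs T) (\<Union>p\<in>P. set (root_path p)) i q t"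
proof -
  let ?H = "\<Union>p\<in>P. set (root_path p)"
  have i: "i \<in> pverts T" using assms by auto
  have H: "?H \<subseteq> pverts T" using assms(2) in_root_path_verts by blast
  have "i \<noteq> r" using assms(3) root_path_root root_path_props(4)[OF assms(4)] by auto
  have child: "x \<in> set (root_path i)" if x: "x \<in> ?H" "x \<noteq> r" "parent x \<in> set (i # q)" for x
  proof -
    obtain p where p: "p \<in> P" "x \<in> set (root_path p)" using x by auto
    have "x \<in> pverts T" using x H by blast
    then have "parent x \<in> set (root_path p)"
      using root_path_step[of x] x(2) self_in_root_path[of "parent x"] root_path_subset[of p x] p assms(2) by auto
    with x(3) have "p = i" using assms(5)[OF p(1)] by auto
    with p show ?thesis by simp
  qed
  have "chain (parcs T) ?H i q t"
    using child by (intro chain_tree[OF i self_in_root_path[OF i] assms(3,4) H]) auto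
  moreover have "(i, x) \<in> parcs T \<longleftrightarrow> x = hd (q @ [t])" if "x \<in> ?H" for x
  proof -
    have "parent i = hd (q @ [t])"
      using assms(3) root_path_props(2,4)[OF assms(4)] by (cases q) (auto simp: parent_def)
    \<comment> \<open>A child of \<open>i\<close> on the root path of \<open>i\<close> would be
      deeper than \<open>i\<close>.\<close>
    moreover have "parent x \<noteq> i" if "x \<noteq> r"
    proof
      assume *: "parent x = i"
      have "x \<in> set (root_path i)" using child[OF \<open>x \<in> ?H\<close> that] * by simp
      then have "length (root_path x) \<le> length (root_path i)" using in_root_path_split[OF i] by (metis le_add2 length_append)
      then show False using root_path_step(1)[of x] that H \<open>x \<in> ?H\<close> * by auto
    qed
    ultimately show ?thesis
      using adj_iff[OF i, of x] \<open>i \<noteq> r\<close> H that by auto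
  qed
  ultimately show ?thesis by (simp add: leg_def)
qed

end

text \<open>A further vertex on all paths to the new root would lie on all paths to
  \<open>r0\<close> too, and beyond the new root as seen from \<open>r0\<close>; the choice of the
  farthest common vertex excludes this.\<close>

lemma (in utree) new_root:
  assumes "r0 \<in> pverts T" "P \<subseteq> pverts T" "P \<noteq> {}"
  defines "r \<equiv> new_root T r0 P"
  shows "r \<in> pverts T" "(\<Inter>i\<in>P. set (tree_path T i r)) = {r}"
proof -
  interpret R: rooted_tree T r0 using assms by unfold_locales
  let ?C = "(\<Inter>i\<in>P. set (R.root_path i)) - {r0}"
  have r: "r = (if ?C = {} then r0 else arg_max_on (tree_dist T r0) ?C)"
    by (simp add: r_def new_root_def R.root_path_def Let_def)
  have fin: "finite ?C" using assms(3) by auto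
  have CV: "?C \<subseteq> pverts T" using R.in_root_path_verts assms(2,3) by blast
  have mx: "tree_dist T r0 x \<le> tree_dist T r0 r" if "x \<in> ?C" for x
  proof -
    have "r = arg_max_on (tree_dist T r0) ?C" using r that by auto
    \<comment> \<open>\<open>arg_max_nat_lemma\<close> asks for a strict upper bound, hence the
      \<open>Suc\<close>.\<close>
    moreover have "\<forall>y. y \<in> ?C \<longrightarrow> tree_dist T r0 y < Suc (Max (tree_dist T r0 ` ?C))"
      using fin by (auto simp: less_Suc_eq_le)
    ultimately show ?thesis
      using arg_max_nat_lemma[of "\<lambda>x. x \<in> ?C" x "tree_dist T r0" "Suc (Max (tree_dist T r0 ` ?C))"] that
      by (simp add: arg_max_on_def)
  qed
  have rin: "\<forall>i\<in>P. r \<in> set (R.root_path i)"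
  proof (cases "?C = {}")
    case True
    then show ?thesis using r R.root_in_root_path assms(2) by auto
  next
    case False
    then obtain x where x: "x \<in> ?C" by blast
    have "\<forall>y. y \<in> ?C \<longrightarrow> tree_dist T r0 y < Suc (Max (tree_dist T r0 ` ?C))"
      using fin by (auto simp: less_Suc_eq_le)
    then have "arg_max_on (tree_dist T r0) ?C \<in> ?C"
      using arg_max_nat_lemma[of "\<lambda>x. x \<in> ?C" x "tree_dist T r0" "Suc (Max (tree_dist T r0 ` ?C))"] x
      by (simp add: arg_max_on_def)
    then show ?thesis using r False by auto
  qed
  then show rv: "r \<in> pverts T" using assms(2,3) R.in_root_path_verts by blast
  have path: "\<exists>p. R.root_path i = p @ R.root_path r \<and> tree_path T i r = p @ [r]" if "i \<in> P" for i
    using R.in_root_path_split[of i r] rin that assms(2) by (metis subsetD)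
  show "(\<Inter>i\<in>P. set (tree_path T i r)) = {r}"
  proof (intro equalityI subsetI)
    fix x assume "x \<in> {r}"
    then show "x \<in> (\<Inter>i\<in>P. set (tree_path T i r))" using path by fastforce
  next
    fix x assume x: "x \<in> (\<Inter>i\<in>P. set (tree_path T i r))"
    show "x \<in> {r}"
    proof (rule ccontr)
      assume nr: "x \<notin> {r}"
      obtain i where i: "i \<in> P" using assms(3) by blast
      have iv: "i \<in> pverts T" using i assms(2) by blast
      obtain p where p: "R.root_path i = p @ R.root_path r" "x \<in> set p"
        using path[OF i] x i nr by fastforce
      have xin: "x \<in> set (R.root_path j)" if "j \<in> P" for j
        using path[OF that] x that nr by fastforce
      have xv: "x \<in> pverts T" using R.in_root_path_verts[OF iv] xin[OF i] by blast
      \<comment> \<open>The root path of \<open>i\<close> repeats no vertex, and \<open>x\<close> is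
        in the part of it before \<open>r\<close>.\<close>
      have "x \<notin> set (R.root_path r)" using R.root_path_props(5)[OF iv] p by auto
      then have "r \<in> set (R.root_path x)" using R.root_path_chain[OF iv, of x r] xin rin i by blast
      then have "length (R.root_path r) < length (R.root_path x)" using R.root_path_length_less[OF xv] nr by auto
      moreover have "length (R.root_path r) \<noteq> 0" using R.root_path_props(4)[OF rv] by simp
      ultimately have "tree_dist T r0 r < tree_dist T r0 x"
        using R.dist_root xv rv by (cases "length (R.root_path r)") auto
      moreover have "x \<noteq> r0" using \<open>x \<notin> set (R.root_path r)\<close> R.root_in_root_path[OF rv] by auto
      ultimately show False using mx[of x] xin by auto
    qed
  qed
qed

section \<open>Measurements of vertices on a path\<close>

text \<open>A plain first-order form of the locale, so that preservation under the graph operations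
  is a matter of unfolding.\<close>

lemma pair_graph_iff:
  "pair_graph G \<longleftrightarrow> finite (pverts G) \<and> parcs G \<subseteq> pverts G \<times> pverts G \<and>
     (\<forall>x y. (x, y) \<in> parcs G \<longleftrightarrow> (y, x) \<in> parcs G) \<and> (\<forall>x. (x, x) \<notin> parcs G)" (is "?L \<longleftrightarrow> ?R")
proof
  assume ?L
  then interpret pair_graph G .
  have "(y, x) \<in> parcs G" if "(x, y) \<in> parcs G" for x y
    using that pair_sym_arcs by (simp add: symmetric_def sym_def)
  moreover have "(x, x) \<notin> parcs G" for x
    using pair_no_loops[of "(x, x)"] by fastforce
  moreover have "parcs G \<subseteq> pverts G \<times> pverts G"
    using in_arcsD1 in_arcsD2 by fast
  ultimately show ?R
    using pair_finite_verts by (intro conjI allI iffI)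
next
  assume ?R
  then have R: "finite (pverts G)" "parcs G \<subseteq> pverts G \<times> pverts G"
    "\<forall>x y. (x, y) \<in> parcs G \<longleftrightarrow> (y, x) \<in> parcs G" "\<forall>x. (x, x) \<notin> parcs G"
    by - (elim conjE; assumption)+
  have "finite (parcs G)" using finite_subset[OF R(2)] R(1) by simp
  moreover have "sym (parcs G)" by (rule symI) (use R(3) in blast)
  moreover have "fst e \<in> pverts G" "snd e \<in> pverts G" if "e \<in> parcs G" for e
    using that R(2) by auto
  moreover have "fst e \<noteq> snd e" if "e \<in> parcs G" for e
    using that R(4) by (metis prod.collapse)
  ultimately show ?L
    using R(1) by unfold_locales (simp_all add: symmetric_def)
qed

lemma pair_graph_sym: "pair_graph G \<Longrightarrow> (x, y) \<in> parcs G \<longleftrightarrow> (y, x) \<in> parcs G"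
  and pair_graph_irrefl: "pair_graph G \<Longrightarrow> (x, x) \<notin> parcs G"
  unfolding pair_graph_iff by blast+

lemma pair_graph_local_comp:
  assumes "pair_graph G"
  shows "pair_graph (local_comp v G)"
proof -
  have "nbhd G v \<subseteq> pverts G" using assms by (auto simp: pair_graph_iff nbhd_def)
  then show ?thesis using assms unfolding pair_graph_iff local_comp_def by auto
qed

lemma pair_graph_measZ: "pair_graph G \<Longrightarrow> pair_graph (measZ v G)"
  unfolding pair_graph_iff measZ_def by auto

text \<open>The pivot rule: \<open>w\<close> inherits the neighbourhood of \<open>v\<close>, and a
  pair \<open>x, y\<close> is toggled exactly if the 2 by 2 matrix of adjacencies between
  \<open>w, v\<close> and \<open>x, y\<close> has determinant 1 modulo 2. Only arcs among
  \<open>v, w, x, y\<close> enter, which is what makes the restriction to an observed set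
  possible.\<close>

lemma measX:
  assumes G: "pair_graph G" and vw: "(v, w) \<in> parcs G"
  obtains G' where "measX v w G = Some G'" "pair_graph G'" "pverts G' = pverts G - {v}"
    "\<And>y. \<lbrakk>y \<noteq> v; y \<noteq> w\<rbrakk> \<Longrightarrow> (w, y) \<in> parcs G' \<longleftrightarrow> (v, y) \<in> parcs G"
    "\<And>x y. \<lbrakk>x \<noteq> v; x \<noteq> w; y \<noteq> v; y \<noteq> w; x \<noteq> y\<rbrakk> \<Longrightarrow> (x, y) \<in> parcs G' \<longleftrightarrow>
       ((x, y) \<in> parcs G \<longleftrightarrow>
         ((w, x) \<in> parcs G \<and> (v, y) \<in> parcs G \<longleftrightarrow> (w, y) \<in> parcs G \<and> (v, x) \<in> parcs G))"
proof
  have ne: "v \<noteq> w" and wv: "(w, v) \<in> parcs G" using vw pair_graph_sym[OF G] pair_graph_irrefl[OF G] by metis+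
  let ?G1 = "local_comp w G" and ?G2 = "local_comp v (local_comp w G)"
  let ?G3 = "measZ v ?G2"
  let ?G' = "local_comp w ?G3"
  note [simp] = pair_graph_irrefl[OF G]
  have lc: "(x, y) \<in> parcs (local_comp u K) \<longleftrightarrow>
      ((x, y) \<in> parcs K \<longleftrightarrow> \<not> ((u, x) \<in> parcs K \<and> (u, y) \<in> parcs K \<and> x \<noteq> y))" for x y u K
    by (auto simp: local_comp_def nbhd_def)
  have mz: "(x, y) \<in> parcs (measZ u K) \<longleftrightarrow> (x, y) \<in> parcs K \<and> x \<noteq> u \<and> y \<noteq> u" for x y u K
    by (auto simp: measZ_def)
  have g1: "(x, y) \<in> parcs ?G1 \<longleftrightarrow> ((x, y) \<in> parcs G) \<noteq> ((w, x) \<in> parcs G \<and> (w, y) \<in> parcs G)"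
    if "x \<noteq> y" for x y
    using that by (simp add: lc)
  have g1v: "(v, x) \<in> parcs ?G1 \<longleftrightarrow> ((v, x) \<in> parcs G) \<noteq> ((w, x) \<in> parcs G)" if "x \<noteq> v" for x
    using g1[of v x] that wv by simp
  have g1w: "(w, x) \<in> parcs ?G1 \<longleftrightarrow> (w, x) \<in> parcs G" for x
    by (simp add: lc)
  have g2: "(x, y) \<in> parcs ?G2 \<longleftrightarrow> ((x, y) \<in> parcs ?G1) \<noteq> ((v, x) \<in> parcs ?G1 \<and> (v, y) \<in> parcs ?G1)"
    if "x \<noteq> y" for x y
    using that unfolding lc[of x y v] by simp
  \<comment> \<open>Modulo 2: the complementation at \<open>w\<close> adds the neighbourhood of
    \<open>w\<close> to that of \<open>v\<close>, and the one at \<open>v\<close> adds the sum to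
    the neighbourhood of \<open>w\<close>, where the two copies of the latter cancel.\<close>
  have g2w: "(w, x) \<in> parcs ?G2 \<longleftrightarrow> (v, x) \<in> parcs G" if "x \<noteq> v" "x \<noteq> w" for x
    using g2[of w x] g1w[of x] g1v[of w] g1v[of x] that ne vw by auto
  have g4: "(x, y) \<in> parcs ?G' \<longleftrightarrow> ((x, y) \<in> parcs ?G2) \<noteq> ((w, x) \<in> parcs ?G2 \<and> (w, y) \<in> parcs ?G2)"
    if "x \<noteq> y" "x \<noteq> v" "y \<noteq> v" for x y
    using that ne unfolding lc[of x y w ?G3] mz by simp
  have ww: "(w, w) \<notin> parcs ?G2"
    unfolding lc[of w w v] by (simp add: lc)
  show "measX v w G = Some ?G'" using vw by (simp add: measX_def nbhd_def)
  show "pair_graph ?G'" by (intro pair_graph_local_comp pair_graph_measZ G)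
  show "pverts ?G' = pverts G - {v}" by (simp add: local_comp_def measZ_def)
  show "(w, y) \<in> parcs ?G' \<longleftrightarrow> (v, y) \<in> parcs G" if "y \<noteq> v" "y \<noteq> w" for y
    using g4[of w y] ww g2w[of y] that ne by simp
  show "(x, y) \<in> parcs ?G' \<longleftrightarrow> ((x, y) \<in> parcs G \<longleftrightarrow>
      ((w, x) \<in> parcs G \<and> (v, y) \<in> parcs G \<longleftrightarrow> (w, y) \<in> parcs G \<and> (v, x) \<in> parcs G))"
    if "x \<noteq> v" "x \<noteq> w" "y \<noteq> v" "y \<noteq> w" "x \<noteq> y" for x y
    \<comment> \<open>Write \<open>wx\<close> for adjacency modulo 2. The three complementations
      toggle by \<open>wx wy\<close>, \<open>(vx + wx)(vy + wy)\<close> and \<open>vx vy\<close>,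
      whose sum is \<open>wx vy + wy vx\<close>.\<close>
    using g4[of x y] g2w[of x] g2w[of y] g2[of x y] g1[of x y] g1v[of x] g1v[of y] that by argo
qed

section \<open>Contracting legs, as in Step 4\<close>

lemma chain_cong:
  "\<lbrakk>chain A S u q t; S' \<subseteq> S; \<And>v x. \<lbrakk>v \<in> set q; x \<in> S'\<rbrakk> \<Longrightarrow> (v, x) \<in> B \<longleftrightarrow> (v, x) \<in> A\<rbrakk>
    \<Longrightarrow> chain B S' u q t"
proof (induction q arbitrary: u)
  case (Cons w q)
  have "chain B S' w q t"
    using Cons.prems by (intro Cons.IH) simp_all
  moreover have "(w, x) \<in> B \<longleftrightarrow> x = u \<or> x = hd (q @ [t])" if "x \<in> S'" for x
    using Cons.prems(1) Cons.prems(2) Cons.prems(3)[of w x] that by (simp add: subset_iff)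
  ultimately show ?case by simp
qed simp

lemma leg_cong:
  "\<lbrakk>leg A S u q t; S' \<subseteq> S; \<And>v x. \<lbrakk>v \<in> set (u # q); x \<in> S'\<rbrakk> \<Longrightarrow> (v, x) \<in> B \<longleftrightarrow> (v, x) \<in> A\<rbrakk>
    \<Longrightarrow> leg B S' u q t"
  unfolding leg_def using chain_cong[of A S u q t S' B] by (simp add: subset_iff)

lemma measX_seq_append:
  "measX_seq (xs @ ys) G = Option.bind (measX_seq xs G) (measX_seq ys)"
proof (induction xs arbitrary: G)
  case (Cons m xs)
  then show ?case by (cases "measX (fst m) (snd m) G") simp_all
qed simp

text \<open>The vertices in \<open>J\<close> hang on the leg; with every measurement they alternate between being
  attached to the party \<open>i\<close> and to the vertex that follows it.\<close>

lemma route_leg: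
  assumes "pair_graph G" "leg (parcs G) S i q t" "distinct (i # q @ [t])" "set (i # q @ [t]) \<subseteq> S"
    and "J \<inter> S = {}"
    and "\<And>j x. \<lbrakk>j \<in> J; x \<in> S\<rbrakk> \<Longrightarrow> (j, x) \<in> parcs G \<longleftrightarrow> x = (if b then i else hd (q @ [t]))"
  shows "\<exists>G' b'. measX_seq (map (\<lambda>v. (v, i)) q) G = Some G' \<and> pair_graph G' \<and>
    pverts G' = pverts G - set q \<and>
    (\<forall>x\<in>S - set q. (i, x) \<in> parcs G' \<longleftrightarrow> x = t) \<and>
    (\<forall>x\<in>S - set q - {i}. \<forall>y\<in>S - set q - {i}. (x, y) \<in> parcs G' \<longleftrightarrow> (x, y) \<in> parcs G) \<and>
    (\<forall>j\<in>J. \<forall>x\<in>S - set q. (j, x) \<in> parcs G' \<longleftrightarrow> x = (if b' then i else t))"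
  using assms
proof (induction q arbitrary: G S b)
  case Nil
  show ?case
    by (rule exI[of _ G], rule exI[of _ b]) (use Nil in \<open>auto simp: leg_def\<close>)
next
  case (Cons v q)
  note G = Cons.prems(1)
  let ?h = "hd (q @ [t])"
  have Ni: "(i, x) \<in> parcs G \<longleftrightarrow> x = v" and Nv: "(v, x) \<in> parcs G \<longleftrightarrow> x = i \<or> x = ?h" if "x \<in> S" for x
    using Cons.prems(2) that by (auto simp: leg_def)
  have ch: "chain (parcs G) S v q t" using Cons.prems(2) by (simp add: leg_def)
  have NJ: "(j, x) \<in> parcs G \<longleftrightarrow> x = (if b then i else v)" if "j \<in> J" "x \<in> S" for j x
    using Cons.prems(6)[OF that] by simp
  have mem: "i \<in> S" "v \<in> S" "t \<in> S" "set q \<subseteq> S" "?h \<in> S" "?h \<noteq> i" "?h \<noteq> v" "i \<noteq> v" "t \<noteq> v" "v \<notin> set q"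
    "i \<notin> set q" "i \<noteq> t"
    using Cons.prems(3,4) by (cases q; auto)+
  have "(v, i) \<in> parcs G" using Nv mem by simp
  from G this obtain G1 where G1: "measX v i G = Some G1" "pair_graph G1" "pverts G1 = pverts G - {v}"
    and Ei: "\<And>y. \<lbrakk>y \<noteq> v; y \<noteq> i\<rbrakk> \<Longrightarrow> (i, y) \<in> parcs G1 \<longleftrightarrow> (v, y) \<in> parcs G"
    and E: "\<And>x y. \<lbrakk>x \<noteq> v; x \<noteq> i; y \<noteq> v; y \<noteq> i; x \<noteq> y\<rbrakk> \<Longrightarrow> (x, y) \<in> parcs G1 \<longleftrightarrow>
       ((x, y) \<in> parcs G \<longleftrightarrow>
         ((i, x) \<in> parcs G \<and> (v, y) \<in> parcs G \<longleftrightarrow> (i, y) \<in> parcs G \<and> (v, x) \<in> parcs G))"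
    by (rule measX) blast
  let ?S1 = "S - {v}"
  \<comment> \<open>Inside \<open>S\<close> the only neighbour of \<open>i\<close> is
    \<open>v\<close>, so no pair of other vertices is toggled.\<close>
  have same: "(x, y) \<in> parcs G1 \<longleftrightarrow> (x, y) \<in> parcs G" if "x \<in> ?S1" "y \<in> ?S1" "x \<noteq> i" "y \<noteq> i" for x y
    using that E[of x y] Ni pair_graph_irrefl[OF G] pair_graph_irrefl[OF G1(2)] by (cases "x = y") auto
  have Ni1: "(i, x) \<in> parcs G1 \<longleftrightarrow> x = ?h" if "x \<in> ?S1" for x
    using that Ei[of x] Nv[of x] mem pair_graph_irrefl[OF G1(2)] by (cases "x = i") auto
  have "chain (parcs G1) ?S1 i q t"
  proof (cases q)
    case (Cons w ws)
    have "(w, x) \<in> parcs G1 \<longleftrightarrow> x = i \<or> x = hd (ws @ [t])" if "x \<in> ?S1" for x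
    proof (cases "x = i")
      case True
      then show ?thesis using Ni1[of w] mem pair_graph_sym[OF G1(2)] Cons by auto
    next
      case False
      then show ?thesis using ch same[of w x] that mem Cons by auto
    qed
    moreover have "chain (parcs G1) ?S1 w ws t"
    proof (rule chain_cong)
      show "chain (parcs G) S w ws t" using ch Cons by simp
      fix u x assume u: "u \<in> set ws" and x: "x \<in> ?S1"
      have uS: "u \<in> ?S1" "u \<noteq> i" "u \<noteq> w" "u \<noteq> v" using u mem Cons \<open>distinct (i # (v # q) @ [t])\<close> by auto
      show "(u, x) \<in> parcs G1 \<longleftrightarrow> (u, x) \<in> parcs G"
      proof (cases "x = i")
        case True
        then show ?thesis
          using Ni1[of u] Ni[of u] uS Cons pair_graph_sym[OF G1(2)] pair_graph_sym[OF G] by auto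
      next
        case False
        then show ?thesis using same uS x by auto
      qed
    qed auto
    ultimately show ?thesis using Cons by simp
  qed simp
  then have "leg (parcs G1) ?S1 i q t" using Ni1 by (simp add: leg_def)
  \<comment> \<open>If \<open>j\<close> hangs on \<open>i\<close>, it loses \<open>i\<close> because
    \<open>v\<close> is not adjacent to it, and the pair \<open>j, ?h\<close> is toggled into an
    arc. If it hangs on \<open>v\<close>, then \<open>i\<close> inherits it along with the rest of
    the neighbourhood of \<open>v\<close>, and nothing else changes.\<close>
  moreover have NJ1: "(j, x) \<in> parcs G1 \<longleftrightarrow> x = (if \<not> b then i else ?h)" if j: "j \<in> J" and x: "x \<in> ?S1" for j x
  proof -
    have jn: "j \<noteq> i" "j \<noteq> v" "j \<noteq> x" using j x mem Cons.prems(5) by auto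
    have js: "(i, j) \<in> parcs G \<longleftrightarrow> b" "(v, j) \<in> parcs G \<longleftrightarrow> \<not> b"
      using NJ[OF j, of i] NJ[OF j, of v] mem pair_graph_sym[OF G] by auto
    show ?thesis
    proof (cases "x = i")
      case True
      then show ?thesis using Ei[of j] jn js mem pair_graph_sym[OF G1(2), of j i] by auto
    next
      case False
      then show ?thesis
        using E[of j x] jn js x NJ[OF j, of x] Nv[of x] Ni[of x] mem by auto
    qed
  qed
  ultimately have "\<exists>G' b'. measX_seq (map (\<lambda>v. (v, i)) q) G1 = Some G' \<and> pair_graph G' \<and>
    pverts G' = pverts G1 - set q \<and>
    (\<forall>x\<in>?S1 - set q. (i, x) \<in> parcs G' \<longleftrightarrow> x = t) \<and>
    (\<forall>x\<in>?S1 - set q - {i}. \<forall>y\<in>?S1 - set q - {i}. (x, y) \<in> parcs G' \<longleftrightarrow> (x, y) \<in> parcs G1) \<and>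
    (\<forall>j\<in>J. \<forall>x\<in>?S1 - set q. (j, x) \<in> parcs G' \<longleftrightarrow> x = (if b' then i else t))"
  proof (intro Cons.IH[where b = "\<not> b"])
    show "distinct (i # q @ [t])" "set (i # q @ [t]) \<subseteq> ?S1" "J \<inter> ?S1 = {}"
      using Cons.prems(3,4,5) by auto
  qed (use G1(2) in auto)
  then obtain G' b' where G': "measX_seq (map (\<lambda>v. (v, i)) q) G1 = Some G'" "pair_graph G'"
    "pverts G' = pverts G1 - set q"
    "\<forall>x\<in>?S1 - set q. (i, x) \<in> parcs G' \<longleftrightarrow> x = t"
    "\<forall>x\<in>?S1 - set q - {i}. \<forall>y\<in>?S1 - set q - {i}. (x, y) \<in> parcs G' \<longleftrightarrow> (x, y) \<in> parcs G1"
    "\<forall>j\<in>J. \<forall>x\<in>?S1 - set q. (j, x) \<in> parcs G' \<longleftrightarrow> x = (if b' then i else t)"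
    by blast
  have "S - set (v # q) = ?S1 - set q" by auto
  show ?case
    unfolding \<open>S - set (v # q) = ?S1 - set q\<close>
    by (rule exI[of _ G'], rule exI[of _ b']) (use G' G1 same in auto)
qed

text \<open>The legs are contracted one after the other, and the observed set loses the interior of
  each. A leg still to be contracted survives because it is disjoint from the earlier ones; no far
  end is itself among the routed parties, so nothing hangs on a leg here and \<open>J\<close> is
  empty.\<close>

lemma route_legs:
  assumes "pair_graph G" "distinct ps"
    and "\<And>p. p \<in> set ps \<Longrightarrow> leg (parcs G) S p (q p) (t p)"
    and "\<And>p. p \<in> set ps \<Longrightarrow> distinct (p # q p @ [t p])"
    and "\<And>p. p \<in> set ps \<Longrightarrow> set (p # q p @ [t p]) \<subseteq> S"
    and "\<And>p. p \<in> set ps \<Longrightarrow> t p \<notin> set ps"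
    and "\<And>p p'. \<lbrakk>p \<in> set ps; p' \<in> set ps; p \<noteq> p'\<rbrakk> \<Longrightarrow> set (q p) \<inter> set (p' # q p' @ [t p']) = {}"
  shows "\<exists>G'. measX_seq (concat (map (\<lambda>p. map (\<lambda>v. (v, p)) (q p)) ps)) G = Some G' \<and> pair_graph G' \<and>
    pverts G' = pverts G - (\<Union>p\<in>set ps. set (q p)) \<and>
    (\<forall>p\<in>set ps. \<forall>x\<in>S - (\<Union>p\<in>set ps. set (q p)). (p, x) \<in> parcs G' \<longleftrightarrow> x = t p) \<and>
    (\<forall>x\<in>S - (\<Union>p\<in>set ps. set (q p)) - set ps. \<forall>y\<in>S - (\<Union>p\<in>set ps. set (q p)) - set ps.
       (x, y) \<in> parcs G' \<longleftrightarrow> (x, y) \<in> parcs G)"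
  using assms
proof (induction ps arbitrary: G S)
  case Nil
  then show ?case by simp
next
  case (Cons p ps)
  note G = Cons.prems(1)
  have disj: "set (q p) \<inter> set (p' # q p' @ [t p']) = {}" "set (q p') \<inter> set (p # q p @ [t p]) = {}"
    "p' \<noteq> p" "t p' \<noteq> p" "t p' \<notin> set ps" "t p \<noteq> p'" if "p' \<in> set ps" for p'
    using that Cons.prems(2,6) Cons.prems(7)[of p p'] Cons.prems(7)[of p' p] by force+
  obtain G1 where G1: "measX_seq (map (\<lambda>v. (v, p)) (q p)) G = Some G1" "pair_graph G1"
    "pverts G1 = pverts G - set (q p)"
    and p1: "\<And>x. x\<in>S - set (q p) \<Longrightarrow> (p, x) \<in> parcs G1 \<longleftrightarrow> x = t p"
    and same: "\<And>x y. \<lbrakk>x\<in>S - set (q p) - {p}; y\<in>S - set (q p) - {p}\<rbrakk> \<Longrightarrow> (x, y) \<in> parcs G1 \<longleftrightarrow> (x, y) \<in> parcs G"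
    using route_leg[OF G, of S p "q p" "t p" "{}" True] Cons.prems(3,4,5)[of p] by auto
  let ?S1 = "S - set (q p)"
  let ?Q = "\<Union>p\<in>set ps. set (q p)"
  have "\<exists>G'. measX_seq (concat (map (\<lambda>p. map (\<lambda>v. (v, p)) (q p)) ps)) G1 = Some G' \<and> pair_graph G' \<and>
    pverts G' = pverts G1 - ?Q \<and>
    (\<forall>p\<in>set ps. \<forall>x\<in>?S1 - ?Q. (p, x) \<in> parcs G' \<longleftrightarrow> x = t p) \<and>
    (\<forall>x\<in>?S1 - ?Q - set ps. \<forall>y\<in>?S1 - ?Q - set ps.
       (x, y) \<in> parcs G' \<longleftrightarrow> (x, y) \<in> parcs G1)"
  proof (rule Cons.IH)
    fix p' assume p': "p' \<in> set ps"
    show "leg (parcs G1) ?S1 p' (q p') (t p')"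
    proof (rule leg_cong)
      show "leg (parcs G) S p' (q p') (t p')" using Cons.prems(3) p' by simp
      fix u x assume u: "u \<in> set (p' # q p')" and x: "x \<in> ?S1"
      have uS: "u \<in> ?S1" "u \<noteq> p" "u \<noteq> t p" "u \<notin> set (q p)"
        using u disj[OF p'] Cons.prems(5)[of p'] p' by auto
      show "(u, x) \<in> parcs G1 \<longleftrightarrow> (u, x) \<in> parcs G"
      proof (cases "x = p")
        case True
        \<comment> \<open>Before the contraction \<open>p\<close> sees only the first vertex of its
          leg, afterwards only \<open>t p\<close>; \<open>u\<close> is neither.\<close>
        have "u \<noteq> hd (q p @ [t p])" using uS by (cases "q p") auto
        then have "(p, u) \<notin> parcs G" using Cons.prems(3)[of p] uS by (auto simp: leg_def)
        with True p1[OF uS(1)] uS show ?thesis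
          using pair_graph_sym[OF G1(2)] pair_graph_sym[OF G] by auto
      next
        case False
        then show ?thesis using same[of u x] uS x by auto
      qed
    qed auto
  next
    fix p' assume "p' \<in> set ps"
    then show "set (p' # q p' @ [t p']) \<subseteq> ?S1"
      using Cons.prems(5)[of p'] disj(1)[of p'] by auto
  next
    fix p' p'' assume "p' \<in> set ps" "p'' \<in> set ps" "p' \<noteq> p''"
    then show "set (q p') \<inter> set (p'' # q p'' @ [t p'']) = {}"
      using Cons.prems(7)[of p' p''] by simp
  next
    fix p' assume "p' \<in> set ps"
    then show "distinct (p' # q p' @ [t p'])" "t p' \<notin> set ps"
      using Cons.prems(4,6)[of p'] by simp_all
  qed (use Cons.prems(2) G1(2) in auto)
  then obtain G' where G': "measX_seq (concat (map (\<lambda>p. map (\<lambda>v. (v, p)) (q p)) ps)) G1 = Some G'" "pair_graph G'"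
    "pverts G' = pverts G1 - ?Q"
    "\<forall>p\<in>set ps. \<forall>x\<in>?S1 - ?Q. (p, x) \<in> parcs G' \<longleftrightarrow> x = t p"
    "\<forall>x\<in>?S1 - ?Q - set ps. \<forall>y\<in>?S1 - ?Q - set ps. (x, y) \<in> parcs G' \<longleftrightarrow> (x, y) \<in> parcs G1"
    by (elim exE conjE)
  have N': "(p', x) \<in> parcs G' \<longleftrightarrow> x = t p'" if "p' \<in> set ps" "x \<in> ?S1 - ?Q" for p' x
    using bspec[OF bspec[OF G'(4) that(1)] that(2)] .
  have same': "(x, y) \<in> parcs G' \<longleftrightarrow> (x, y) \<in> parcs G1"
    if "x \<in> ?S1 - ?Q - set ps" "y \<in> ?S1 - ?Q - set ps" for x y
    using bspec[OF bspec[OF G'(5) that(1)] that(2)] .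
  have pin: "p \<in> ?S1 - ?Q - set ps"
    using Cons.prems(2) Cons.prems(4)[of p] Cons.prems(5)[of p] disj(2) by auto
  \<comment> \<open>Towards a party \<open>x\<close> that is routed later, the arc is read from the
    side of \<open>x\<close>, whose only neighbour is \<open>t x\<close>, and \<open>t x\<close> is
    not \<open>p\<close>.\<close>
  have "(p, x) \<in> parcs G' \<longleftrightarrow> x = t p" if x: "x \<in> ?S1 - ?Q" for x
  proof (cases "x \<in> set ps")
    case True
    then show ?thesis using N'[of x p] pin pair_graph_sym[OF G'(2), of x p] disj(4,6)[of x] by auto
  next
    case False
    then show ?thesis using same'[of p x] pin x p1[of x] by auto
  qed
  note Np = this
  have S: "S - (\<Union>p\<in>set (p # ps). set (q p)) = ?S1 - ?Q" by auto
  have "(p', x) \<in> parcs G' \<longleftrightarrow> x = t p'" if "p' \<in> set (p # ps)" "x \<in> ?S1 - ?Q" for p' x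
    using Np N' that by (cases "p' = p") simp_all
  moreover have "(x, y) \<in> parcs G' \<longleftrightarrow> (x, y) \<in> parcs G"
    if "x \<in> ?S1 - ?Q - set (p # ps)" "y \<in> ?S1 - ?Q - set (p # ps)" for x y
    using same'[of x y] same[of x y] that by simp
  moreover have "measX_seq (concat (map (\<lambda>p. map (\<lambda>v. (v, p)) (q p)) (p # ps))) G = Some G'"
    using G1(1) G'(1) by (simp add: measX_seq_append)
  moreover have "pverts G' = pverts G - (\<Union>p\<in>set (p # ps). set (q p))"
    using G1(3) G'(3) by auto
  ultimately show ?case
    unfolding S using G'(2) by blast
qed

section \<open>Moving along the path of Step 5(c)\<close>

fun hops :: "'a list \<Rightarrow> ('a \<times> 'a) list" where
  "hops (x # y # z # zs) = (y, x) # hops (z # zs)"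
| "hops xs = []"

text \<open>The protocol numbers the path from 1, so vertex \<open>s\<close> is entry
  \<open>s - 1\<close>. Dropping two vertices shifts \<open>s\<close> by 2 and preserves its parity;
  the bound \<open>s < length p\<close> spares the last vertex, as the recursion does by stopping
  below three vertices.\<close>

lemma hops_conv_nth:
  "map (\<lambda>s. (p ! (s - 1), p ! (s - 1 - 1))) (filter even [2..<length p]) = hops p"
proof (induction p rule: hops.induct)
  case (1 x y z zs)
  let ?f = "\<lambda>s. ((x # y # z # zs) ! (s - 1), (x # y # z # zs) ! (s - 1 - 1))"
  let ?n = "length (z # zs)"
  have upt: "[4..<n + 2] = map (\<lambda>s. s + 2) [2..<n]" for n
    by (rule nth_equalityI) (simp_all del: upt_Suc)
  have "filter even [2..<length (x # y # z # zs)] = 2 # filter even [4..<?n + 2]"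
    by (cases zs) (simp_all add: upt_conv_Cons del: upt_Suc)
  also have "\<dots> = 2 # map (\<lambda>s. s + 2) (filter even [2..<?n])"
    unfolding upt filter_map by (simp add: o_def)
  finally have "map ?f (filter even [2..<length (x # y # z # zs)]) =
      ?f 2 # map (\<lambda>s. ?f (s + 2)) (filter even [2..<?n])"
    by (simp only: list.map map_map o_def)
  also have "map (\<lambda>s. ?f (s + 2)) (filter even [2..<?n]) =
    map (\<lambda>s. ((z # zs) ! (s - 1), (z # zs) ! (s - 1 - 1))) (filter even [2..<?n])"
    by (intro map_cong) (auto simp: nth_Cons' numeral_eq_Suc)
  finally show ?case using "1.IH" by simp
qed auto

text \<open>The vertices of \<open>J\<close> see \<open>a\<close>, and \<open>v\<close> sees its
  successor, so measuring \<open>v\<close> with basis \<open>a\<close> toggles just the pairs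
  joining \<open>J\<close> to that successor. Pairs inside \<open>J\<close> stay, since
  \<open>v\<close> has no neighbour in \<open>J\<close>. The vertex \<open>a\<close> survives, but
  is observed no longer.\<close>

lemma hop:
  assumes "pair_graph G" "leg (parcs G) S a (v # q) r" "distinct (a # v # q @ [r])"
    "set (a # v # q @ [r]) \<subseteq> S" and "J \<inter> S = {}"
    and "\<And>j x. \<lbrakk>j \<in> J; x \<in> S\<rbrakk> \<Longrightarrow> (j, x) \<in> parcs G \<longleftrightarrow> x = a"
  shows "\<exists>G'. measX v a G = Some G' \<and> pair_graph G' \<and> pverts G' = pverts G - {v} \<and>
    (\<forall>x\<in>S - {a, v}. \<forall>y\<in>S - {a, v}. (x, y) \<in> parcs G' \<longleftrightarrow> (x, y) \<in> parcs G) \<and>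
    (\<forall>x\<in>J. \<forall>y\<in>J. (x, y) \<in> parcs G' \<longleftrightarrow> (x, y) \<in> parcs G) \<and>
    (\<forall>j\<in>J. \<forall>x\<in>S - {a, v}. (j, x) \<in> parcs G' \<longleftrightarrow> x = hd (q @ [r]))"
proof -
  note G = assms(1)
  have Na: "(a, x) \<in> parcs G \<longleftrightarrow> x = v" and Nv: "(v, x) \<in> parcs G \<longleftrightarrow> x = a \<or> x = hd (q @ [r])"
    if "x \<in> S" for x
    using assms(2) that by (auto simp: leg_def)
  have mem: "a \<in> S" "v \<in> S" "a \<noteq> v" using assms(3,4) by auto
  have NJ: "j \<notin> S" "j \<noteq> a" "j \<noteq> v" "(a, j) \<in> parcs G" "(v, j) \<notin> parcs G" if "j \<in> J" for j
    using assms(5) assms(6)[OF that, of a] assms(6)[OF that, of v] that mem pair_graph_sym[OF G] by auto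
  have "(v, a) \<in> parcs G" using Nv mem by simp
  from G this obtain G' where G': "measX v a G = Some G'" "pair_graph G'" "pverts G' = pverts G - {v}"
    and E: "\<And>x y. \<lbrakk>x \<noteq> v; x \<noteq> a; y \<noteq> v; y \<noteq> a; x \<noteq> y\<rbrakk> \<Longrightarrow> (x, y) \<in> parcs G' \<longleftrightarrow>
       ((x, y) \<in> parcs G \<longleftrightarrow>
         ((a, x) \<in> parcs G \<and> (v, y) \<in> parcs G \<longleftrightarrow> (a, y) \<in> parcs G \<and> (v, x) \<in> parcs G))"
    by (rule measX) blast
  note irr = pair_graph_irrefl[OF G] pair_graph_irrefl[OF G'(2)]
  have "(x, y) \<in> parcs G' \<longleftrightarrow> (x, y) \<in> parcs G" if "x \<in> S - {a, v}" "y \<in> S - {a, v}" for x y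
    using E[of x y] Na that irr by (cases "x = y") auto
  moreover have "(x, y) \<in> parcs G' \<longleftrightarrow> (x, y) \<in> parcs G" if "x \<in> J" "y \<in> J" for x y
    using E[of x y] NJ that irr by (cases "x = y") auto
  moreover have "(j, x) \<in> parcs G' \<longleftrightarrow> x = hd (q @ [r])" if "j \<in> J" "x \<in> S - {a, v}" for j x
    using E[of j x] NJ[OF that(1)] assms(6)[OF that(1), of x] Nv[of x] Na[of x] that by auto
  ultimately show ?thesis using G' by blast
qed

text \<open>One hop moves \<open>J\<close> two vertices on, after which the induction starts again
  from there. The end \<open>h\<close> is \<open>r\<close> if \<open>q\<close> has odd length;
  otherwise it is the vertex before \<open>r\<close>, which is \<open>a\<close> itself for empty
  \<open>q\<close>. Only every other vertex of \<open>q\<close> is measured, hence a mere inclusion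
  for the vertex sets.\<close>

lemma hops_leg:
  assumes "pair_graph G" "leg (parcs G) S a q r" "distinct (a # q @ [r])"
    "set (a # q @ [r]) \<subseteq> S" and "J \<inter> S = {}"
    and "\<And>j x. \<lbrakk>j \<in> J; x \<in> S\<rbrakk> \<Longrightarrow> (j, x) \<in> parcs G \<longleftrightarrow> x = a"
  defines "h \<equiv> if even (length q) then last (a # q) else r"
  shows "\<exists>G'. measX_seq (hops (a # q @ [r])) G = Some G' \<and> pair_graph G' \<and>
    pverts G - set q \<subseteq> pverts G' \<and>
    (\<forall>x\<in>insert h (S - set (a # q)). \<forall>y\<in>insert h (S - set (a # q)). (x, y) \<in> parcs G' \<longleftrightarrow> (x, y) \<in> parcs G) \<and>
    (\<forall>x\<in>J. \<forall>y\<in>J. (x, y) \<in> parcs G' \<longleftrightarrow> (x, y) \<in> parcs G) \<and>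
    (\<forall>j\<in>J. \<forall>x\<in>insert h (S - set (a # q)). (j, x) \<in> parcs G' \<longleftrightarrow> x = h)"
  using assms(1-6) unfolding h_def
proof (induction q arbitrary: a G S rule: induct_list012)
  case 1
  then show ?case by simp
next
  case (2 v)
  have "\<exists>G'. measX v a G = Some G' \<and> pair_graph G' \<and> pverts G' = pverts G - {v} \<and>
    (\<forall>x\<in>S - {a, v}. \<forall>y\<in>S - {a, v}. (x, y) \<in> parcs G' \<longleftrightarrow> (x, y) \<in> parcs G) \<and>
    (\<forall>x\<in>J. \<forall>y\<in>J. (x, y) \<in> parcs G' \<longleftrightarrow> (x, y) \<in> parcs G) \<and>
    (\<forall>j\<in>J. \<forall>x\<in>S - {a, v}. (j, x) \<in> parcs G' \<longleftrightarrow> x = r)"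
    using hop[of G S a v "[]" r J] 2 by simp
  moreover have "insert r (S - set [a, v]) = S - {a, v}" using 2 by auto
  ultimately show ?case using 2 by auto
next
  case (3 v z q)
  let ?S1 = "S - {a, v}"
  from hop[of G S a v "z # q" r J] "3.prems" obtain G1 where G1: "measX v a G = Some G1" "pair_graph G1" "pverts G1 = pverts G - {v}"
    and same: "\<And>x y. \<lbrakk>x \<in> ?S1; y \<in> ?S1\<rbrakk> \<Longrightarrow> (x, y) \<in> parcs G1 \<longleftrightarrow> (x, y) \<in> parcs G"
    and sameJ: "\<And>x y. \<lbrakk>x \<in> J; y \<in> J\<rbrakk> \<Longrightarrow> (x, y) \<in> parcs G1 \<longleftrightarrow> (x, y) \<in> parcs G"
    and NJ: "\<And>j x. \<lbrakk>j \<in> J; x \<in> ?S1\<rbrakk> \<Longrightarrow> (j, x) \<in> parcs G1 \<longleftrightarrow> x = z"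
    by auto
  have lz: "leg (parcs G1) ?S1 z q r"
  proof (rule leg_cong)
    show "leg (parcs G) ?S1 z q r"
      using "3.prems"(2) chain_cong[of "parcs G" S z q r ?S1 "parcs G"] by (auto simp: leg_def)
    show "(w, x) \<in> parcs G1 \<longleftrightarrow> (w, x) \<in> parcs G" if "w \<in> set (z # q)" "x \<in> ?S1" for w x
      using same[of w x] that "3.prems"(3,4) by auto
  qed simp
  let ?h = "if even (length q) then last (z # q) else r"
  have "\<exists>G'. measX_seq (hops (z # q @ [r])) G1 = Some G' \<and> pair_graph G' \<and>
    pverts G1 - set q \<subseteq> pverts G' \<and>
    (\<forall>x\<in>insert ?h (?S1 - set (z # q)). \<forall>y\<in>insert ?h (?S1 - set (z # q)). (x, y) \<in> parcs G' \<longleftrightarrow> (x, y) \<in> parcs G1) \<and>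
    (\<forall>x\<in>J. \<forall>y\<in>J. (x, y) \<in> parcs G' \<longleftrightarrow> (x, y) \<in> parcs G1) \<and>
    (\<forall>j\<in>J. \<forall>x\<in>insert ?h (?S1 - set (z # q)). (j, x) \<in> parcs G' \<longleftrightarrow> x = ?h)"
    using "3.prems"(3-5) G1(2) lz NJ by (intro "3.IH"(1)) auto
  then obtain G' where G': "measX_seq (hops (z # q @ [r])) G1 = Some G'" "pair_graph G'"
    "pverts G1 - set q \<subseteq> pverts G'"
    "\<forall>x\<in>insert ?h (?S1 - set (z # q)). \<forall>y\<in>insert ?h (?S1 - set (z # q)). (x, y) \<in> parcs G' \<longleftrightarrow> (x, y) \<in> parcs G1"
    "\<forall>x\<in>J. \<forall>y\<in>J. (x, y) \<in> parcs G' \<longleftrightarrow> (x, y) \<in> parcs G1"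
    "\<forall>j\<in>J. \<forall>x\<in>insert ?h (?S1 - set (z # q)). (j, x) \<in> parcs G' \<longleftrightarrow> x = ?h"
    by (elim exE conjE)
  have h: "(if even (length (v # z # q)) then last (a # v # z # q) else r) = ?h" by simp
  have S: "insert ?h (S - set (a # v # z # q)) = insert ?h (?S1 - set (z # q))" by auto
  have "last (z # q) \<in> set (z # q)" by (rule last_in_set) simp
  \<comment> \<open>\<open>?h\<close> may be a vertex of the contracted path, so it has to be
    checked that it lies where \<open>G1\<close> and \<open>G\<close> agree.\<close>
  then have hS: "insert ?h (?S1 - set (z # q)) \<subseteq> ?S1"
    using "3.prems"(3,4) by (auto simp del: last.simps)
  have E1: "\<forall>x\<in>insert ?h (?S1 - set (z # q)). \<forall>y\<in>insert ?h (?S1 - set (z # q)). (x, y) \<in> parcs G' \<longleftrightarrow> (x, y) \<in> parcs G"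
  proof (intro ballI)
    fix x y assume xy: "x \<in> insert ?h (?S1 - set (z # q))" "y \<in> insert ?h (?S1 - set (z # q))"
    then show "(x, y) \<in> parcs G' \<longleftrightarrow> (x, y) \<in> parcs G"
      using bspec[OF bspec[OF G'(4) xy(1)] xy(2)] same[OF subsetD[OF hS xy(1)] subsetD[OF hS xy(2)]] by blast
  qed
  have E2: "\<forall>x\<in>J. \<forall>y\<in>J. (x, y) \<in> parcs G' \<longleftrightarrow> (x, y) \<in> parcs G"
    using G'(5) sameJ by simp
  have E3: "measX_seq (hops (a # (v # z # q) @ [r])) G = Some G'"
    using G1(1) G'(1) by simp
  have E4: "pverts G - set (v # z # q) \<subseteq> pverts G'"
    using G1(3) G'(3) by auto
  show ?case
    unfolding h S by (rule exI[of _ G']) (intro conjI E1 E2 E3 E4 G'(2,6))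
qed

section \<open>The steps of the protocol\<close>

text \<open>Total correctness of a nondeterministic step: non-emptiness excludes vacuous truth,
  \<open>Some\<close> excludes a breakdown.\<close>

definition always :: "('a pair_pre_digraph \<Rightarrow> bool) \<Rightarrow> 'a outcomes \<Rightarrow> bool" where
  "always Q R \<longleftrightarrow> R \<noteq> {} \<and> (\<forall>x\<in>R. \<exists>G. x = Some G \<and> Q G)"

lemma always_single: "always Q {x} \<longleftrightarrow> (\<exists>G. x = Some G \<and> Q G)"
  by (simp add: always_def)

text \<open>The sequencing rule, with \<open>Q\<close> as the intermediate assertion.\<close>

lemma always_and_then:
  assumes "always Q R" "\<And>G. Q G \<Longrightarrow> always Q' (f G)"
  shows "always Q' (R and_then f)"
proof -
  obtain x where "x \<in> R" using assms(1) by (auto simp: always_def)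
  moreover obtain G where "x = Some G" "Q G" using assms(1) \<open>x \<in> R\<close> by (auto simp: always_def)
  moreover obtain y where "y \<in> f G" using assms(2)[OF \<open>Q G\<close>] by (auto simp: always_def)
  ultimately have "y \<in> R and_then f" by (auto simp: and_then_def intro!: bexI[of _ x])
  moreover have "\<exists>G. y = Some G \<and> Q' G" if y: "y \<in> R and_then f" for y
  proof -
    obtain x where x: "x \<in> R" "y \<in> (case x of None \<Rightarrow> {None} | Some G \<Rightarrow> f G)"
      using y by (auto simp: and_then_def)
    then obtain G where "x = Some G" "Q G" using assms(1) by (auto simp: always_def)
    with x assms(2) show ?thesis by (auto simp: always_def)
  qed
  ultimately show ?thesis by (auto simp: always_def)
qed

lemma always_choose:
  assumes "A \<noteq> {}" "\<And>x. x \<in> A \<Longrightarrow> always Q (f x)"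
  shows "always Q (choose_from A f)"
proof -
  obtain x where x: "x \<in> A" using assms(1) by blast
  then have "(\<Union>x\<in>A. f x) \<noteq> {}" using assms(2)[OF x] by (auto simp: always_def)
  moreover have "\<exists>G. y = Some G \<and> Q G" if "y \<in> (\<Union>x\<in>A. f x)" for y
    using that assms(2) unfolding always_def by blast
  ultimately show ?thesis
    using assms(1) by (simp add: choose_from_def always_def)
qed

text \<open>The interface between Steps 6 and 7. A spanning star suffices for connectedness and
  survives the deletion of non-parties; arcs leaving \<open>P\<close> are left open, since Step 7
  cuts them.\<close>

definition has_hub :: "'a set \<Rightarrow> 'a pair_pre_digraph \<Rightarrow> bool" where
  "has_hub P G \<longleftrightarrow> pair_graph G \<and> P \<subseteq> pverts G \<and> (\<exists>c\<in>P. \<forall>x\<in>P - {c}. (c, x) \<in> parcs G)"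

section \<open>Step 7\<close>

lemma fold_measZ:
  "pverts (fold measZ vs G) = pverts G - set vs"
  "(x, y) \<in> parcs (fold measZ vs G) \<longleftrightarrow> (x, y) \<in> parcs G \<and> x \<notin> set vs \<and> y \<notin> set vs"
  by (induction vs arbitrary: G) (auto simp: measZ_def)

lemma pair_graph_fold_measZ: "pair_graph G \<Longrightarrow> pair_graph (fold measZ vs G)"
  by (induction vs arbitrary: G) (simp_all add: pair_graph_measZ)

text \<open>\<open>connected\<close> is strong connectedness of the symmetric closure, in which any
  two vertices are linked through \<open>c\<close>.\<close>

lemma connected_star:
  assumes "pair_graph G" "c \<in> P" "\<And>x. \<lbrakk>x \<in> P; x \<noteq> c\<rbrakk> \<Longrightarrow> (c, x) \<in> parcs G"
  shows "connected (with_proj G \<restriction> P)"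
proof -
  let ?M = "mk_symmetric (with_proj G \<restriction> P)"
  have "wf_digraph (with_proj G \<restriction> P)" by unfold_locales auto
  then interpret M: pair_wf_digraph ?M
    by (rule wf_digraph.wellformed_mk_symmetric)
  have v: "pverts ?M = P" by (simp add: mk_symmetric_def)
  have arcs: "(c, x) \<in> parcs ?M" "(x, c) \<in> parcs ?M" if "x \<in> P" "x \<noteq> c" for x
    using assms(2) assms(3)[OF that] that by (auto simp: mk_symmetric_def)
  have c: "c \<rightarrow>\<^sup>*\<^bsub>with_proj ?M\<^esub> x" "x \<rightarrow>\<^sup>*\<^bsub>with_proj ?M\<^esub> c" if "x \<in> P" for x
    using that arcs[of x] v M.reachable_refl[of c] M.reachable_adjI[of c x] M.reachable_adjI[of x c]
    by (cases "x = c"; simp)+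
  show ?thesis
    unfolding connected_def
  proof (rule strongly_connectedI)
    show "verts (with_proj ?M) \<noteq> {}" using v assms(2) by auto
    fix x y assume "x \<in> verts (with_proj ?M)" "y \<in> verts (with_proj ?M)"
    then show "x \<rightarrow>\<^sup>*\<^bsub>with_proj ?M\<^esub> y" using c(2)[of x] c(1)[of y] v M.reachable_trans[of x c y] by simp
  qed
qed

lemma step7_has_hub:
  assumes "has_hub P G"
  shows "always (\<lambda>G. entangled_exactly G P) (step7 P G)"
proof -
  have G: "pair_graph G" "P \<subseteq> pverts G" using assms by (auto simp: has_hub_def)
  obtain c where c: "c \<in> P" "\<And>x. x \<in> P - {c} \<Longrightarrow> (c, x) \<in> parcs G" using assms by (auto simp: has_hub_def)
  let ?N = "{v \<in> pverts G. v \<notin> P \<and> (\<exists>i\<in>P. v \<in> nbhd G i)}"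
  have "finite ?N" using G by (auto simp: pair_graph_iff)
  then have "step7 P G \<noteq> {}"
    using finite_distinct_list[of ?N] by (auto simp: step7_def)
  moreover have "entangled_exactly (fold measZ vs G) P" if vs: "set vs = ?N" for vs
    unfolding entangled_exactly_def
  proof (intro conjI ballI)
    let ?G = "fold measZ vs G"
    have pg: "pair_graph ?G" using G(1) by (rule pair_graph_fold_measZ)
    show "P \<subseteq> pverts ?G" using G vs by (auto simp: fold_measZ)
    show "connected (with_proj ?G \<restriction> P)"
      using c vs by (intro connected_star[OF pg, of c]) (auto simp: fold_measZ)
    show "nbhd ?G i \<subseteq> P" if "i \<in> P" for i
    proof
      fix x assume x: "x \<in> nbhd ?G i"
      then have "x \<in> nbhd G i" "x \<notin> set vs" by (auto simp: nbhd_def fold_measZ)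
      moreover have "x \<in> pverts G" using x G(1) by (auto simp: nbhd_def fold_measZ pair_graph_iff)
      ultimately show "x \<in> P" using that vs by auto
    qed
  qed
  ultimately show ?thesis by (auto simp: always_def step7_def)
qed

text \<open>If \<open>r\<close> is a party, it is the hub. Otherwise the chosen party inherits the
  neighbourhood of \<open>r\<close>, which contains all other parties, so any choice yields a
  hub.\<close>

lemma step6_star:
  assumes "pair_graph G" "P \<subseteq> pverts G" "P \<noteq> {}"
    and "\<And>p x. \<lbrakk>p \<in> P; p \<noteq> r; x \<in> insert r P\<rbrakk> \<Longrightarrow> (p, x) \<in> parcs G \<longleftrightarrow> x = r"
  shows "always (has_hub P) (step6 r P G)"
proof (cases "r \<in> P")
  case True
  have "(r, x) \<in> parcs G" if "x \<in> P - {r}" for x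
    using assms(4)[of x r] pair_graph_sym[OF assms(1), of x r] that by simp
  then have "has_hub P G" using True assms(1,2) unfolding has_hub_def by blast
  with True show ?thesis by (simp add: step6_def always_def)
next
  case False
  have rp: "(r, p) \<in> parcs G" if "p \<in> P" for p
    using assms(4)[of p r] pair_graph_sym[OF assms(1), of p r] that False by auto
  have "always (has_hub P) {measX r i G}" if i: "i \<in> P" for i
  proof -
    obtain G' where G': "measX r i G = Some G'" "pair_graph G'" "pverts G' = pverts G - {r}"
      "\<And>y. \<lbrakk>y \<noteq> r; y \<noteq> i\<rbrakk> \<Longrightarrow> (i, y) \<in> parcs G' \<longleftrightarrow> (r, y) \<in> parcs G"
      by (rule measX[OF assms(1) rp[OF i]]) blast
    then have "has_hub P G'" using i rp False assms(2) by (auto simp: has_hub_def intro!: bexI[of _ i])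
    with G' show ?thesis by (simp add: always_def)
  qed
  moreover have "{i \<in> P. i \<in> nbhd G r} = P" using rp by (auto simp: nbhd_def)
  ultimately show ?thesis
    using False assms(3) by (auto simp: step6_def intro!: always_choose)
qed

text \<open>The shape is \<open>x - y - r\<close>, continued by \<open>z\<close> if
  \<open>z \<noteq> r\<close>. Only \<open>y\<close> and \<open>z\<close> can serve as basis, and
  the hub is the one that was not chosen; if \<open>z = r\<close>, nothing is measured and
  \<open>y\<close> is the hub.\<close>

lemma step6_path:
  assumes G: "pair_graph G" "{x, y, z} \<subseteq> pverts G" and d: "distinct [x, y, r]" "z \<notin> {x, y}"
    and N: "(x, y) \<in> parcs G" "(x, r) \<notin> parcs G" "(y, r) \<in> parcs G"
      "z \<noteq> r \<Longrightarrow> (z, x) \<notin> parcs G \<and> (z, y) \<notin> parcs G \<and> (z, r) \<in> parcs G"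
  shows "always (has_hub {x, y, z}) (step6 r {x, y, z} G)"
proof -
  note sym = pair_graph_sym[OF G(1)]
  have S: "(y, x) \<in> parcs G" "(r, x) \<notin> parcs G" "(r, y) \<in> parcs G"
    using N sym[of x y] sym[of x r] sym[of y r] by auto
  show ?thesis
  proof (cases "z = r")
    case True
    then have "has_hub {x, y, z} G" using G N S by (auto simp: has_hub_def)
    with True show ?thesis by (simp add: step6_def always_def)
  next
    case False
    have Z: "(z, x) \<notin> parcs G" "(z, y) \<notin> parcs G" "(z, r) \<in> parcs G"
      "(x, z) \<notin> parcs G" "(y, z) \<notin> parcs G" "(r, z) \<in> parcs G"
      using N(4)[OF False] sym[of x z] sym[of y z] sym[of r z] by auto
    have ry: "always (has_hub {x, y, z}) {measX r y G}"
    proof -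
      obtain G' where G': "measX r y G = Some G'" "pair_graph G'" "pverts G' = pverts G - {r}"
        "\<And>w. \<lbrakk>w \<noteq> r; w \<noteq> y\<rbrakk> \<Longrightarrow> (y, w) \<in> parcs G' \<longleftrightarrow> (r, w) \<in> parcs G"
        "\<And>u w. \<lbrakk>u \<noteq> r; u \<noteq> y; w \<noteq> r; w \<noteq> y; u \<noteq> w\<rbrakk> \<Longrightarrow> (u, w) \<in> parcs G' \<longleftrightarrow>
          ((u, w) \<in> parcs G \<longleftrightarrow>
            ((y, u) \<in> parcs G \<and> (r, w) \<in> parcs G \<longleftrightarrow> (y, w) \<in> parcs G \<and> (r, u) \<in> parcs G))"
        by (rule measX[OF G(1) S(3)]) blast
      have "(z, y) \<in> parcs G'" using pair_graph_sym[OF G'(2), of z y] G'(4)[of z] Z d False by auto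
      \<comment> \<open>This pair is toggled: \<open>y\<close> is adjacent to \<open>x\<close> and
        \<open>r\<close> to \<open>z\<close>, while \<open>y\<close> and \<open>z\<close> as well as
        \<open>r\<close> and \<open>x\<close> are not adjacent.\<close>
      moreover have "(z, x) \<in> parcs G'" using G'(5)[of z x] Z S N d False by auto
      ultimately have "has_hub {x, y, z} G'" using G' d False G by (auto simp: has_hub_def)
      with G' show ?thesis by (simp add: always_def)
    qed
    have rz: "always (has_hub {x, y, z}) {measX r z G}"
    proof -
      obtain G' where G': "measX r z G = Some G'" "pair_graph G'" "pverts G' = pverts G - {r}"
        "\<And>w. \<lbrakk>w \<noteq> r; w \<noteq> z\<rbrakk> \<Longrightarrow> (z, w) \<in> parcs G' \<longleftrightarrow> (r, w) \<in> parcs G"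
        "\<And>u w. \<lbrakk>u \<noteq> r; u \<noteq> z; w \<noteq> r; w \<noteq> z; u \<noteq> w\<rbrakk> \<Longrightarrow> (u, w) \<in> parcs G' \<longleftrightarrow>
          ((u, w) \<in> parcs G \<longleftrightarrow>
            ((z, u) \<in> parcs G \<and> (r, w) \<in> parcs G \<longleftrightarrow> (z, w) \<in> parcs G \<and> (r, u) \<in> parcs G))"
        by (rule measX[OF G(1) Z(6)]) blast
      have "(y, z) \<in> parcs G'" using pair_graph_sym[OF G'(2), of y z] G'(4)[of y] S d False by auto
      \<comment> \<open>Neither \<open>x\<close> nor \<open>y\<close> is a neighbour of the basis
        \<open>z\<close>, so their arc is not toggled.\<close>
      moreover have "(y, x) \<in> parcs G'" using G'(5)[of y x] Z S N d False by auto
      ultimately have "has_hub {x, y, z} G'" using G' d False G by (auto simp: has_hub_def)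
      with G' show ?thesis by (simp add: always_def)
    qed
    have "{i \<in> {x, y, z}. i \<in> nbhd G r} = {y, z}" using S Z by (auto simp: nbhd_def)
    with ry rz False d show ?thesis
      by (auto simp: step6_def intro!: always_choose)
  qed
qed

lemma arg_min_on_eqI:
  fixes f :: "'a \<Rightarrow> nat"
  assumes "c \<in> S" "\<And>x. \<lbrakk>x \<in> S; x \<noteq> c\<rbrakk> \<Longrightarrow> f c < f x"
  shows "arg_min_on f S = c"
proof -
  have "is_arg_min f (\<lambda>x. x \<in> S) x \<longleftrightarrow> x = c" for x
    using assms by (auto simp: is_arg_min_def) (metis not_less_iff_gr_or_eq)
  then show ?thesis by (simp add: arg_min_on_def arg_min_def)
qed

section \<open>Routing in the initial tree\<close>

context rooted_tree
begin

definition inner_path where "inner_path x t = butlast (tl (tree_path T x t))"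

lemma inner_path:
  assumes "x \<in> pverts T" "t \<in> set (root_path x)" "t \<noteq> x"
  shows "tree_path T x t = x # inner_path x t @ [t]" "root_path x = x # inner_path x t @ root_path t" "distinct (x # inner_path x t @ [t])"
    "set (x # inner_path x t) \<inter> set (root_path t) = {}" "set (x # inner_path x t @ [t]) \<subseteq> set (root_path x)"
proof -
  have t: "t \<in> pverts T" using assms in_root_path_verts by blast
  obtain p where p: "root_path x = p @ root_path t" "tree_path T x t = p @ [t]" using in_root_path_split assms by metis
  have "p \<noteq> []"
    using p(1) assms root_path_props(2)[OF assms(1)] root_path_props(2)[OF t] by auto
  then obtain q where q: "p = x # q"
    using p(1) root_path_props(2)[OF assms(1)] by (cases p) auto
  then have s: "inner_path x t = q" using p(2) by (simp add: inner_path_def)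
  show "tree_path T x t = x # inner_path x t @ [t]" "root_path x = x # inner_path x t @ root_path t"
    using p q s by auto
  then show "distinct (x # inner_path x t @ [t])" "set (x # inner_path x t) \<inter> set (root_path t) = {}"
    "set (x # inner_path x t @ [t]) \<subseteq> set (root_path x)"
    using root_path_props(5)[OF assms(1)] self_in_root_path[OF t] by auto
qed

text \<open>A party below a further intersection node has only that node and \<open>r\<close> to
  compare, and this inequality decides which is nearest.\<close>

lemma dist_less:
  assumes "x \<in> pverts T" "t \<in> set (root_path x)" "t \<noteq> r"
  shows "tree_dist T x t < tree_dist T x r"
proof -
  have t: "t \<in> pverts T" using assms in_root_path_verts by blast
  obtain p where p: "root_path x = p @ root_path t" "tree_path T x t = p @ [t]" using in_root_path_split assms by metis
  have "root_path t = t # root_path (parent t)" "root_path (parent t) \<noteq> []"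
    using root_path_step[OF t assms(3)] root_path_props(4) by auto
  then have "length (root_path t) > 1" by (cases "root_path (parent t)") auto
  with p show ?thesis by (simp add: tree_dist_length root_path_def)
qed

text \<open>The single hypothesis \<open>disj\<close>, that a routed leg avoids the root paths of
  all other parties, yields everything needed: the legs are disjoint, no party is measured, and no
  far end is itself routed. \<open>S\<close> is what remains of the union of the root paths.\<close>

lemma routes_tree:
  assumes P: "P \<subseteq> pverts T" "P \<noteq> {}" and ps: "distinct ps" "set ps \<subseteq> P"
    and near: "\<And>p. p \<in> set ps \<Longrightarrow> nearest_inter_node T r P p = t p"
    and t: "\<And>p. p \<in> set ps \<Longrightarrow> t p \<in> set (root_path p) \<and> t p \<noteq> p"
    and disj: "\<And>p p'. \<lbrakk>p \<in> set ps; p' \<in> P; p' \<noteq> p\<rbrakk> \<Longrightarrow> set (p # inner_path p (t p)) \<inter> set (root_path p') = {}"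
  defines "S \<equiv> (\<Union>p\<in>P. set (root_path p)) - (\<Union>p\<in>set ps. set (inner_path p (t p)))"
  obtains G where "measX_seq (concat (map (route T r P) ps)) T = Some G" "pair_graph G" "P \<subseteq> pverts G"
    "insert r P \<subseteq> S"
    "\<And>p x. \<lbrakk>p \<in> set ps; x \<in> S\<rbrakk> \<Longrightarrow> (p, x) \<in> parcs G \<longleftrightarrow> x = t p"
    "\<And>x y. \<lbrakk>x \<in> S - set ps; y \<in> S - set ps\<rbrakk> \<Longrightarrow> (x, y) \<in> parcs G \<longleftrightarrow> (x, y) \<in> parcs T"
proof -
  have pv: "p \<in> pverts T" "p \<in> P" if "p \<in> set ps" for p using that P ps by auto
  have tv: "t p \<in> pverts T" if "p \<in> set ps" for p using t[OF that] in_root_path_verts[OF pv(1)] that by blast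
  note sg = inner_path[OF pv(1) conjunct1[OF t] conjunct2[OF t]]
  have "\<exists>G. measX_seq (concat (map (\<lambda>p. map (\<lambda>v. (v, p)) (inner_path p (t p))) ps)) T = Some G \<and> pair_graph G \<and>
    pverts G = pverts T - (\<Union>p\<in>set ps. set (inner_path p (t p))) \<and>
    (\<forall>p\<in>set ps. \<forall>x\<in>S. (p, x) \<in> parcs G \<longleftrightarrow> x = t p) \<and>
    (\<forall>x\<in>S - set ps. \<forall>y\<in>S - set ps. (x, y) \<in> parcs G \<longleftrightarrow> (x, y) \<in> parcs T)"
    unfolding S_def
  proof (rule route_legs)
    show "pair_graph T" by (rule pair_graph_axioms)
    show "distinct ps" by fact
  next
    fix p assume p: "p \<in> set ps"
    show "leg (parcs T) (\<Union>p\<in>P. set (root_path p)) p (inner_path p (t p)) (t p)"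
      using leg_tree[OF pv(2)[OF p] P(1) sg(2)[OF p p p] tv[OF p]] disj[OF p] by blast
    show "distinct (p # inner_path p (t p) @ [t p])" by (rule sg(3)[OF p p p])
    show "set (p # inner_path p (t p) @ [t p]) \<subseteq> (\<Union>p\<in>P. set (root_path p))"
      using sg(5)[OF p p p] pv(2)[OF p] by blast
    \<comment> \<open>A routed \<open>t p\<close> would start a leg with a vertex on the root path
      of \<open>p\<close>.\<close>
    show "t p \<notin> set ps"
    proof
      assume "t p \<in> set ps"
      then show False using disj[of "t p" p] t[OF p] pv(2)[OF p] by auto
    qed
  next
    fix p p' assume p: "p \<in> set ps" "p' \<in> set ps" "p \<noteq> p'"
    show "set (inner_path p (t p)) \<inter> set (p' # inner_path p' (t p') @ [t p']) = {}"
      using disj[OF p(1) pv(2)[OF p(2)]] p(3) sg(5)[OF p(2) p(2) p(2)] by auto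
  qed
  then obtain G where G: "measX_seq (concat (map (\<lambda>p. map (\<lambda>v. (v, p)) (inner_path p (t p))) ps)) T = Some G" "pair_graph G"
    "pverts G = pverts T - (\<Union>p\<in>set ps. set (inner_path p (t p)))"
    "\<forall>p\<in>set ps. \<forall>x\<in>S. (p, x) \<in> parcs G \<longleftrightarrow> x = t p"
    "\<forall>x\<in>S - set ps. \<forall>y\<in>S - set ps. (x, y) \<in> parcs G \<longleftrightarrow> (x, y) \<in> parcs T"
    by (elim exE conjE)
  have "map (route T r P) ps = map (\<lambda>p. map (\<lambda>v. (v, p)) (inner_path p (t p))) ps"
    using near by (auto simp: route_def inner_path_def)
  then have "measX_seq (concat (map (route T r P) ps)) T = Some G" using G(1) by (simp only:)
  moreover have nP: "p' \<notin> set (inner_path p (t p))" if p: "p \<in> set ps" "p' \<in> P" for p p'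
  proof (cases "p' = p")
    case True
    then show ?thesis using sg(3)[OF p(1) p(1) p(1)] by auto
  next
    case False
    then show ?thesis using disj[OF p False] self_in_root_path[of p'] p P by auto
  qed
  then have "P \<subseteq> pverts G" using G(3) P by auto
  moreover have nr: "r \<notin> set (inner_path p (t p))" if p: "p \<in> set ps" for p
    using sg(4)[OF p p p] root_in_root_path[OF tv[OF p]] by auto
  have "r \<in> S" using P root_in_root_path nr unfolding S_def by auto
  moreover have "P \<subseteq> S"
  proof
    fix p' assume "p' \<in> P"
    then show "p' \<in> S" using nP P(1) self_in_root_path[of p'] unfolding S_def by auto
  qed
  ultimately show thesis
    using that[of G] G(2) bspec[OF bspec[OF G(4)]] bspec[OF bspec[OF G(5)]] by simp
qed

lemma always_SomeI: "Q G \<Longrightarrow> always Q {Some G}"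
  by (simp add: always_def)

lemma always_step4:
  assumes "finite P"
    and "\<And>xs ys. \<lbrakk>distinct xs; set xs = P - {r} - inter_nodes T r P;
      distinct ys; set ys = (P - {r}) \<inter> inter_nodes T r P\<rbrakk> \<Longrightarrow>
      \<exists>G. measX_seq (concat (map (route T r P) (xs @ ys))) T = Some G \<and> Q G"
  shows "always Q (step4 T r P T)"
proof -
  obtain xs where "set xs = P - {r} - inter_nodes T r P" "distinct xs"
    using finite_distinct_list[of "P - {r} - inter_nodes T r P"] assms(1) by auto
  moreover obtain ys where "set ys = (P - {r}) \<inter> inter_nodes T r P" "distinct ys"
    using finite_distinct_list[of "(P - {r}) \<inter> inter_nodes T r P"] assms(1) by auto
  ultimately have "xs @ ys \<in> routing_orders T r P" by (auto simp: routing_orders_def)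
  then have "step4 T r P T \<noteq> {}" by (auto simp: step4_def)
  moreover have "\<exists>G. x = Some G \<and> Q G" if "x \<in> step4 T r P T" for x
    using that assms(2) unfolding step4_def routing_orders_def by blast
  ultimately show ?thesis by (simp add: always_def)
qed

section \<open>All intersection nodes at the root\<close>

lemma inter_node_rootI:
  "\<lbrakk>i \<in> pverts T; j \<in> pverts T; set (root_path i) \<inter> set (root_path j) = {r}\<rbrakk> \<Longrightarrow> inter_node T r i j = r"
  using inter_node_eqI[OF _ _ root] root_path_root by simp

lemma arg_min_on_singleton: "arg_min_on (f :: 'a \<Rightarrow> nat) {c} = c"
  by (rule arg_min_on_eqI) auto

lemma protocol_star:
  assumes P: "P \<subseteq> pverts T" "finite P" and ij: "i0 \<in> P" "j0 \<in> P" "i0 \<noteq> j0"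
    and sep: "\<And>i j. \<lbrakk>i \<in> P; j \<in> P; i \<noteq> j\<rbrakk> \<Longrightarrow> set (root_path i) \<inter> set (root_path j) = {r}"
  shows "always (has_hub P) (step4 T r P T and_then step5 T r P and_then step6 r P)"
proof -
  have inter: "inter_node T r i j = r" if "i \<in> P" "j \<in> P" "i \<noteq> j" for i j
    using inter_node_rootI sep[OF that] P that by blast
  have nodes: "inter_nodes T r P = {r}"
    using inter ij unfolding inter_nodes_def by force
  have near: "nearest_inter_node T r P p = r" if "p \<in> P" "p \<noteq> r" for p
  proof -
    have "\<exists>j. j \<in> P \<and> j \<noteq> p" using ij by metis
    then have "{inter_node T r p j |j. j \<in> P - {p}} - {p} = {r}"
      using inter[OF that(1)] that by force
    then show ?thesis by (simp add: nearest_inter_node_def arg_min_on_singleton)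
  qed
  let ?Q = "\<lambda>G. pair_graph G \<and> P \<subseteq> pverts G \<and>
    (\<forall>p\<in>P - {r}. \<forall>x\<in>insert r P. (p, x) \<in> parcs G \<longleftrightarrow> x = r)"
  have "always ?Q (step4 T r P T)"
  proof (rule always_step4[OF P(2)])
    fix xs ys assume o: "distinct xs" "set xs = P - {r} - inter_nodes T r P"
      "distinct ys" "set ys = (P - {r}) \<inter> inter_nodes T r P"
    let ?ps = "xs @ ys"
    have ps: "distinct ?ps" "set ?ps = P - {r}" using o nodes by auto
    have pr: "p \<in> P" "p \<noteq> r" "p \<in> pverts T" if "p \<in> set ?ps" for p using that ps P by auto
    show "\<exists>G. measX_seq (concat (map (route T r P) ?ps)) T = Some G \<and> ?Q G"
    proof (rule routes_tree[OF P(1) _ ps(1), of "\<lambda>_. r"])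
      show "P \<noteq> {}" "set ?ps \<subseteq> P" using ij ps by auto
      show "nearest_inter_node T r P p = r" if "p \<in> set ?ps" for p using near pr[OF that] by simp
      show "r \<in> set (root_path p) \<and> r \<noteq> p" if "p \<in> set ?ps" for p using pr[OF that] root_in_root_path by simp
      show "set (p # inner_path p r) \<inter> set (root_path p') = {}" if "p \<in> set ?ps" "p' \<in> P" "p' \<noteq> p" for p p'
        using sep[of p p'] that pr[OF that(1)] inner_path(3,5)[of p r] root_in_root_path[of p] by auto
      fix G assume G: "measX_seq (concat (map (route T r P) ?ps)) T = Some G" "pair_graph G" "P \<subseteq> pverts G"
        "insert r P \<subseteq> (\<Union>p\<in>P. set (root_path p)) - (\<Union>p\<in>set ?ps. set (inner_path p r))"
        "\<And>p x. \<lbrakk>p \<in> set ?ps; x \<in> (\<Union>p\<in>P. set (root_path p)) - (\<Union>p\<in>set ?ps. set (inner_path p r))\<rbrakk>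
           \<Longrightarrow> (p, x) \<in> parcs G \<longleftrightarrow> x = r"
      have "(p, x) \<in> parcs G \<longleftrightarrow> x = r" if "p \<in> P - {r}" "x \<in> insert r P" for p x
      proof (rule G(5)[OF _ subsetD[OF G(4) that(2)]])
        show "p \<in> set ?ps" using that(1) ps(2) by simp
      qed
      with G(1-3) show ?thesis by (intro exI[of _ G] conjI ballI)
    qed
  qed
  \<comment> \<open>With \<open>r\<close> as the only intersection node, Step 5 is in its idle case
    (a).\<close>
  then have "always ?Q (step4 T r P T and_then step5 T r P)"
    by (rule always_and_then) (simp add: step5_def nodes always_def)
  then show ?thesis
  proof (rule always_and_then)
    fix G assume "?Q G"
    then show "always (has_hub P) (step6 r P G)"
      using ij by (intro step6_star) auto
  qed
qed

section \<open>An intersection node that is a party\<close>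

lemma disjoint_from_branch:
  assumes "a \<in> pverts T" "a \<noteq> r" "set (root_path a) \<inter> set (root_path k) = {r}"
  shows "set (a # inner_path a r) \<inter> set (root_path k) = {}"
  using inner_path(4,5)[OF assms(1) root_in_root_path[OF assms(1)]] assms(2,3) root_path_root by auto

text \<open>Transfers the path from \<open>a\<close> to \<open>r\<close> from the tree to the graph
  after the leaf parties have been routed. The observed set also contains \<open>k\<close>: on the
  branch of \<open>a\<close> it sees only \<open>r\<close> in \<open>G\<close>, and in
  \<open>T\<close> at most \<open>r\<close>.\<close>

lemma leg_cong_tree:
  assumes a: "a \<in> pverts T" "a \<noteq> r" and k: "k \<in> pverts T"
    and sep: "set (root_path a) \<inter> set (root_path k) = {r}" and G: "pair_graph G"
    and same: "\<And>x y. \<lbrakk>x \<in> set (root_path a); y \<in> set (root_path a)\<rbrakk> \<Longrightarrow> (x, y) \<in> parcs G \<longleftrightarrow> (x, y) \<in> parcs T"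
    and Gk: "\<And>x. \<lbrakk>k \<noteq> r; x \<in> set (root_path a)\<rbrakk> \<Longrightarrow> (k, x) \<in> parcs G \<longleftrightarrow> x = r"
  shows "leg (parcs G) (insert k (set (root_path a))) a (inner_path a r) r"
proof (rule leg_cong)
  have disj: "set (a # inner_path a r) \<inter> set (root_path k) = {}" by (rule disjoint_from_branch[OF a sep])
  show "leg (parcs T) (\<Union>p\<in>{a, k}. set (root_path p)) a (inner_path a r) r"
    using leg_tree[of a "{a, k}" "inner_path a r" r] inner_path(2)[OF a(1) root_in_root_path[OF a(1)]] a k root disj by auto
  show "insert k (set (root_path a)) \<subseteq> (\<Union>p\<in>{a, k}. set (root_path p))"
    using self_in_root_path[OF k] by auto
  fix u x assume u: "u \<in> set (a # inner_path a r)" and x: "x \<in> insert k (set (root_path a))"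
  have ua: "u \<in> set (root_path a)" using u inner_path(5)[OF a(1) root_in_root_path[OF a(1)]] a by auto
  show "(u, x) \<in> parcs G \<longleftrightarrow> (u, x) \<in> parcs T"
  proof (cases "x \<in> set (root_path a)")
    case True
    then show ?thesis by (rule same[OF ua])
  next
    case False
    then have xk: "x = k" "k \<noteq> r" using x root_in_root_path[OF a(1)] by auto
    have "u \<noteq> r" using u disj root_in_root_path[OF k] by auto
    then have "(u, k) \<notin> parcs G" using Gk[OF xk(2) ua] pair_graph_sym[OF G] by blast
    \<comment> \<open>The one observed neighbour of \<open>k\<close> in the tree is on the root path
      of \<open>k\<close>, which meets that of \<open>a\<close> in \<open>r\<close> only.\<close>
    moreover have "(k, u) \<notin> parcs T"
    proof -
      have "set (root_path k) \<inter> set (root_path a) = {r}" using sep by blast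
      from disjoint_from_branch[OF k xk(2) this]
      have "leg (parcs T) (\<Union>p\<in>{a, k}. set (root_path p)) k (inner_path k r) r"
        using leg_tree[of k "{a, k}" "inner_path k r" r] inner_path(2)[OF k root_in_root_path[OF k]] xk a k root by auto
      then have "(k, u) \<in> parcs T \<longleftrightarrow> u = hd (inner_path k r @ [r])" using ua by (auto simp: leg_def)
      moreover have "hd (inner_path k r @ [r]) \<in> set (inner_path k r @ [r])" by (cases "inner_path k r") auto
      moreover have "set (inner_path k r @ [r]) \<subseteq> set (root_path k)" using inner_path(5)[OF k root_in_root_path[OF k]] xk by auto
      ultimately show ?thesis using sep ua \<open>u \<noteq> r\<close> by auto
    qed
    ultimately show ?thesis using xk parcs_sym by blast
  qed
qed

lemma distinct_set_singleton: "\<lbrakk>distinct xs; set xs = {x}\<rbrakk> \<Longrightarrow> xs = [x]"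
  by (cases xs) (auto simp: subset_singleton_iff)

text \<open>\<open>j\<close> lies on the way from \<open>i\<close> to \<open>r\<close>, and
  \<open>k\<close> is in another branch or is the root. Leaf parties are routed first, so
  \<open>i\<close> is already adjacent to \<open>j\<close> when the leg of \<open>j\<close> is
  contracted, and is dragged along.\<close>

lemma protocol_party_inter_node:
  assumes V: "{i, j, k} \<subseteq> pverts T" and d: "distinct [i, j, k]" "j \<noteq> r"
    and ij: "j \<in> set (root_path i)" and sep: "set (root_path i) \<inter> set (root_path k) = {r}" "set (root_path j) \<inter> set (root_path k) = {r}"
  defines "P \<equiv> {i, j, k}"
  shows "always (has_hub P) (step4 T r P T and_then step5 T r P and_then step6 r P)"
proof -
  have i: "i \<in> pverts T" and j: "j \<in> pverts T" and k: "k \<in> pverts T" and P: "P \<subseteq> pverts T" "P \<noteq> {}"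
    using V by (auto simp: P_def)
  have ir: "i \<noteq> r" using ij d(2) root_path_root by auto
  have sub: "set (root_path j) \<subseteq> set (root_path i)" using root_path_subset[OF i ij] .
  have inter: "inter_node T r i j = j" "inter_node T r j i = j" "inter_node T r i k = r"
    "inter_node T r k i = r" "inter_node T r j k = r" "inter_node T r k j = r"
    using sub sep i j k by (auto intro!: inter_node_eqI[OF _ _ j] inter_node_rootI)
  have nodes: "inter_nodes T r P = {j, r}"
  proof
    show "inter_nodes T r P \<subseteq> {j, r}"
      using inter unfolding inter_nodes_def P_def by auto
    show "{j, r} \<subseteq> inter_nodes T r P"
      using inter(1,3) d unfolding inter_nodes_def P_def by force
  qed
  have near_i: "nearest_inter_node T r P i = j"
  proof -
    have "{inter_node T r i x |x. x \<in> P - {i}} - {i} = {j, r}"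
      using inter(1,3) d ir unfolding P_def by force
    then show ?thesis
      unfolding nearest_inter_node_def using dist_less[OF i ij d(2)] by (intro arg_min_on_eqI) auto
  qed
  have near_j: "nearest_inter_node T r P j = r"
  proof -
    have "{inter_node T r j x |x. x \<in> P - {j}} - {j} = {r}"
      using inter(2,5) d unfolding P_def by force
    then show ?thesis by (simp add: nearest_inter_node_def arg_min_on_singleton)
  qed
  have near_k: "nearest_inter_node T r P k = r" if "k \<noteq> r"
  proof -
    have "{inter_node T r k x |x. x \<in> P - {k}} - {k} = {r}"
      using inter(4,6) d that unfolding P_def by force
    then show ?thesis by (simp add: nearest_inter_node_def arg_min_on_singleton)
  qed
  have sj: "root_path j = j # inner_path j r @ [r]" "distinct (j # inner_path j r @ [r])"
    using inner_path(2,3)[OF j root_in_root_path[OF j]] d(2) root_path_root by auto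
  have knj: "k \<notin> set (j # inner_path j r)"
    using disjoint_from_branch[OF j d(2) sep(2)] self_in_root_path[OF k] by blast
  let ?t = "\<lambda>p. if p = i then j else r"
  \<comment> \<open>\<open>b\<close> stands for the parity of the leg of \<open>j\<close>: after an
    even number of measurements \<open>i\<close> is back at \<open>j\<close>, and the shape is a
    path; after an odd number \<open>i\<close> hangs on \<open>r\<close> like \<open>j\<close>,
    which gives a star. Step 6 is checked for both values.\<close>
  let ?Q = "\<lambda>G. pair_graph G \<and> P \<subseteq> pverts G \<and> (\<exists>b.
    (\<forall>x\<in>{j, k, r}. (i, x) \<in> parcs G \<longleftrightarrow> x = (if b then j else r)) \<and>
    (\<forall>x\<in>{j, k, r}. (j, x) \<in> parcs G \<longleftrightarrow> x = r) \<and> (k \<noteq> r \<longrightarrow> (k, r) \<in> parcs G))"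
  have "always ?Q (step4 T r P T)"
  proof (rule always_step4)
    show "finite P" by (simp add: P_def)
    fix xs ys assume o: "distinct xs" "set xs = P - {r} - inter_nodes T r P"
      "distinct ys" "set ys = (P - {r}) \<inter> inter_nodes T r P"
    have "set ys = {j}" using o(4) d nodes unfolding P_def by auto
    then have ys: "ys = [j]" using o(3) by (intro distinct_set_singleton)
    have xs: "set xs = {i, k} - {r}" using o(2) d ir nodes unfolding P_def by auto
    show "\<exists>G. measX_seq (concat (map (route T r P) (xs @ ys))) T = Some G \<and> ?Q G"
    proof (rule routes_tree[OF P o(1), of ?t])
      show "set xs \<subseteq> P" using xs unfolding P_def by auto
      show "nearest_inter_node T r P p = ?t p" if "p \<in> set xs" for p
        using that xs near_i near_k by auto
      show "?t p \<in> set (root_path p) \<and> ?t p \<noteq> p" if "p \<in> set xs" for p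
        using that xs ij d root_in_root_path[OF k] by auto
      show "set (p # inner_path p (?t p)) \<inter> set (root_path p') = {}" if p: "p \<in> set xs" "p' \<in> P" "p' \<noteq> p" for p p'
      proof (cases "p = i")
        case True
        have s: "set (i # inner_path i j) \<inter> set (root_path j) = {}" "set (i # inner_path i j) \<subseteq> set (root_path i)"
          using inner_path(4,5)[OF i ij] d by auto
        moreover have "set (i # inner_path i j) \<inter> set (root_path k) \<subseteq> {r}" using s(2) sep(1) by blast
        moreover have "r \<in> set (root_path j)" using root_in_root_path[OF j] .
        ultimately show ?thesis using True p(2,3) unfolding P_def by auto
      next
        case False
        then have pk: "p = k" "k \<noteq> r" using p xs by auto
        have "set (k # inner_path k r) \<inter> {r} = {}" "set (k # inner_path k r) \<subseteq> set (root_path k)"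
          using inner_path(4,5)[OF k root_in_root_path[OF k]] pk root_path_root by auto
        moreover have "p' = i \<or> p' = j" using p(2,3) pk unfolding P_def by auto
        ultimately show ?thesis using False pk sep by auto
      qed
      let ?S = "(\<Union>p\<in>P. set (root_path p)) - (\<Union>p\<in>set xs. set (inner_path p (?t p)))"
      fix G assume G: "measX_seq (concat (map (route T r P) xs)) T = Some G" "pair_graph G" "P \<subseteq> pverts G"
        "insert r P \<subseteq> ?S"
        "\<And>p x. \<lbrakk>p \<in> set xs; x \<in> ?S\<rbrakk> \<Longrightarrow> (p, x) \<in> parcs G \<longleftrightarrow> x = ?t p"
        "\<And>x y. \<lbrakk>x \<in> ?S - set xs; y \<in> ?S - set xs\<rbrakk> \<Longrightarrow> (x, y) \<in> parcs G \<longleftrightarrow> (x, y) \<in> parcs T"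
      have si: "set (i # inner_path i j) \<inter> set (root_path j) = {}" using inner_path(4)[OF i ij] d by auto
      have sk: "x \<notin> set (k # inner_path k r)" if "x \<in> set (root_path j)" "k \<noteq> r" for x
      proof -
        have "set (root_path k) \<inter> set (root_path j) = {r}" using sep by blast
        from disjoint_from_branch[OF k that(2) this] that(1) show ?thesis by blast
      qed
      have paj: "set (root_path j) \<subseteq> ?S - set xs"
      proof
        fix x assume x: "x \<in> set (root_path j)"
        have "x \<notin> set (inner_path p (?t p)) \<and> x \<noteq> p" if "p \<in> set xs" for p
          using that xs si sk[OF x] x by auto
        with x show "x \<in> ?S - set xs" unfolding P_def by auto
      qed
      \<comment> \<open>\<open>i\<close> has to leave the observed set, being the vertex that hangs
        on the leg of \<open>j\<close>. \<open>k\<close> stays in it, so that its arc to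
        \<open>r\<close> is not lost sight of.\<close>
      let ?L = "insert k (set (root_path j))"
      have LS: "?L \<subseteq> ?S" using paj G(4) unfolding P_def by auto
      have ij': "i \<notin> ?L" using si d by auto
      have Gi: "(i, x) \<in> parcs G \<longleftrightarrow> x = j" if "x \<in> ?L" for x
        using G(5)[of i x] subsetD[OF LS that] xs ir by simp
      have Gk: "(k, x) \<in> parcs G \<longleftrightarrow> x = r" if "k \<noteq> r" "x \<in> ?L" for x
        using G(5)[of k x] subsetD[OF LS that(2)] that(1) xs d not_sym[of i k] by simp
      have same: "(x, y) \<in> parcs G \<longleftrightarrow> (x, y) \<in> parcs T" if "x \<in> set (root_path j)" "y \<in> set (root_path j)" for x y
        by (rule G(6)[OF subsetD[OF paj that(1)] subsetD[OF paj that(2)]])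
      have leg: "leg (parcs G) ?L j (inner_path j r) r"
        using leg_cong_tree[OF j d(2) k sep(2) G(2) same] Gk by blast
      have "\<exists>G' b'. measX_seq (map (\<lambda>v. (v, j)) (inner_path j r)) G = Some G' \<and> pair_graph G' \<and>
        pverts G' = pverts G - set (inner_path j r) \<and>
        (\<forall>x\<in>?L - set (inner_path j r). (j, x) \<in> parcs G' \<longleftrightarrow> x = r) \<and>
        (\<forall>x\<in>?L - set (inner_path j r) - {j}. \<forall>y\<in>?L - set (inner_path j r) - {j}. (x, y) \<in> parcs G' \<longleftrightarrow> (x, y) \<in> parcs G) \<and>
        (\<forall>i'\<in>{i}. \<forall>x\<in>?L - set (inner_path j r). (i', x) \<in> parcs G' \<longleftrightarrow> x = (if b' then j else r))"
      proof (rule route_leg[OF G(2) leg sj(2)])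
        show "set (j # inner_path j r @ [r]) \<subseteq> ?L" using sj(1) by auto
        show "{i} \<inter> ?L = {}" using ij' by simp
        show "(i', x) \<in> parcs G \<longleftrightarrow> x = (if True then j else hd (inner_path j r @ [r]))"
          if "i' \<in> {i}" "x \<in> ?L" for i' x
          using Gi that by simp
      qed
      then obtain G' b' where G': "measX_seq (map (\<lambda>v. (v, j)) (inner_path j r)) G = Some G'" "pair_graph G'"
        "pverts G' = pverts G - set (inner_path j r)"
        "\<forall>x\<in>?L - set (inner_path j r). (j, x) \<in> parcs G' \<longleftrightarrow> x = r"
        "\<forall>x\<in>?L - set (inner_path j r) - {j}. \<forall>y\<in>?L - set (inner_path j r) - {j}. (x, y) \<in> parcs G' \<longleftrightarrow> (x, y) \<in> parcs G"
        "\<forall>i'\<in>{i}. \<forall>x\<in>?L - set (inner_path j r). (i', x) \<in> parcs G' \<longleftrightarrow> x = (if b' then j else r)"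
        by (elim exE conjE)
      have jkr: "{j, k, r} \<subseteq> ?L - set (inner_path j r)" using sj knj by auto
      have "route T r P j = map (\<lambda>v. (v, j)) (inner_path j r)"
        by (simp add: route_def inner_path_def near_j)
      then have "measX_seq (concat (map (route T r P) (xs @ ys))) T = Some G'"
        using G(1) G'(1) ys by (simp add: measX_seq_append)
      moreover have "P \<subseteq> pverts G'"
      proof -
        have "i \<notin> set (inner_path j r)" "j \<notin> set (inner_path j r)" "k \<notin> set (inner_path j r)"
          using ij' knj sj by auto
        then show ?thesis using G(3) G'(3) unfolding P_def by auto
      qed
      moreover have "(i, x) \<in> parcs G' \<longleftrightarrow> x = (if b' then j else r)" if "x \<in> {j, k, r}" for x
        using bspec[OF bspec[OF G'(6) singletonI] subsetD[OF jkr that]] .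
      moreover have "(j, x) \<in> parcs G' \<longleftrightarrow> x = r" if "x \<in> {j, k, r}" for x
        using bspec[OF G'(4) subsetD[OF jkr that]] .
      moreover have "(k, r) \<in> parcs G'" if "k \<noteq> r"
      proof -
        have "k \<in> ?L - set (inner_path j r) - {j}" "r \<in> ?L - set (inner_path j r) - {j}" using jkr d by auto
        from bspec[OF bspec[OF G'(5) this(1)] this(2)] Gk[OF that, of r] root_in_root_path[OF j]
        show ?thesis by simp
      qed
      ultimately show ?thesis
        using G'(2) by (intro exI[of _ G'] conjI exI[of _ b']) blast+
    qed
  qed
  then have "always ?Q (step4 T r P T and_then step5 T r P)"
  proof (rule always_and_then)
    fix G assume Q: "?Q G"
    \<comment> \<open>Case (b): the intersection node \<open>j\<close> is a party other than the
      root.\<close>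
    have "step5 T r P G = {Some G}"
      unfolding step5_def nodes using d(2) by (simp add: P_def)
    then show "always ?Q (step5 T r P G)" by (simp only:) (rule always_SomeI, rule Q)
  qed
  then show ?thesis
  proof (rule always_and_then)
    fix G assume "?Q G"
    then obtain b where G: "pair_graph G" "P \<subseteq> pverts G"
      "\<forall>x\<in>{j, k, r}. (i, x) \<in> parcs G \<longleftrightarrow> x = (if b then j else r)"
      "\<forall>x\<in>{j, k, r}. (j, x) \<in> parcs G \<longleftrightarrow> x = r" "k \<noteq> r \<longrightarrow> (k, r) \<in> parcs G"
      by (elim exE conjE)
    note sym = pair_graph_sym[OF G(1), of k i] pair_graph_sym[OF G(1), of k j] pair_graph_sym[OF G(1), of j i]
    note irr = pair_graph_irrefl[OF G(1), of i] pair_graph_irrefl[OF G(1), of j] pair_graph_irrefl[OF G(1), of k]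
    show "always (has_hub P) (step6 r P G)"
    proof (cases b)
      case True
      show ?thesis
        unfolding P_def using G True d ir sym unfolding P_def by (intro step6_path) auto
    next
      case False
      have "(p, x) \<in> parcs G \<longleftrightarrow> x = r" if "p \<in> P" "p \<noteq> r" "x \<in> insert r P" for p x
        using that G(3,4,5) False d ir sym irr unfolding P_def by auto
      then show ?thesis using G P by (intro step6_star) auto
    qed
  qed
qed

end

text \<open>The final measurement of Step 5(c). \<open>h\<close> joins \<open>i\<close>,
  \<open>j\<close> and \<open>r\<close>; measuring it with basis \<open>i\<close> hands
  \<open>j\<close> and \<open>r\<close> over to \<open>i\<close> and toggles nothing between
  \<open>j\<close> and \<open>r\<close>. What remains is the path \<open>j - i - r\<close>,
  continued by \<open>k\<close> unless \<open>k = r\<close>.\<close>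

lemma step6_after_measX:
  assumes G: "pair_graph G" "{i, j, k} \<subseteq> pverts G" and d: "distinct [i, j, k, h]" "r \<notin> {i, j, h}"
    and ih: "(i, h) \<in> parcs G" "(j, h) \<in> parcs G" "(h, r) \<in> parcs G" "(i, j) \<notin> parcs G"
    and ir: "(i, r) \<notin> parcs G" "(j, r) \<notin> parcs G"
    and k: "k \<noteq> r \<Longrightarrow> (i, k) \<notin> parcs G \<and> (j, k) \<notin> parcs G \<and> (h, k) \<notin> parcs G \<and> (k, r) \<in> parcs G"
  shows "\<exists>G'. measX h i G = Some G' \<and> always (has_hub {i, j, k}) (step6 r {i, j, k} G')"
proof -
  note sym = pair_graph_sym[OF G(1)]
  have hi: "(h, i) \<in> parcs G" "(h, j) \<in> parcs G" using ih sym[of h i] sym[of h j] by auto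
  obtain G' where G': "measX h i G = Some G'" "pair_graph G'" "pverts G' = pverts G - {h}"
    and Ei: "\<And>w. \<lbrakk>w \<noteq> h; w \<noteq> i\<rbrakk> \<Longrightarrow> (i, w) \<in> parcs G' \<longleftrightarrow> (h, w) \<in> parcs G"
    and E: "\<And>u w. \<lbrakk>u \<noteq> h; u \<noteq> i; w \<noteq> h; w \<noteq> i; u \<noteq> w\<rbrakk> \<Longrightarrow> (u, w) \<in> parcs G' \<longleftrightarrow>
          ((u, w) \<in> parcs G \<longleftrightarrow>
            ((i, u) \<in> parcs G \<and> (h, w) \<in> parcs G \<longleftrightarrow> (i, w) \<in> parcs G \<and> (h, u) \<in> parcs G))"
    by (rule measX[OF G(1) hi(1)]) blast
  have n: "(j, i) \<in> parcs G'" "(j, r) \<notin> parcs G'" "(i, r) \<in> parcs G'"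
    using Ei[of j] Ei[of r] E[of j r] hi ih ir d pair_graph_sym[OF G'(2), of j i] by auto
  have kn: "(k, j) \<notin> parcs G' \<and> (k, i) \<notin> parcs G' \<and> (k, r) \<in> parcs G'" if "k \<noteq> r"
    using Ei[of k] E[of k j] E[of k r] k[OF that] that hi ih ir d sym[of k j] pair_graph_sym[OF G'(2), of k i] by auto
  have "{j, i, k} \<subseteq> pverts G'" using G(2) G'(3) d by auto
  moreover have "distinct [j, i, r]" "k \<notin> {j, i}" using d by auto
  ultimately have "always (has_hub {j, i, k}) (step6 r {j, i, k} G')"
    using n kn by (intro step6_path[OF G'(2)]) auto
  then show ?thesis using G'(1) by (simp add: insert_commute)
qed

lemma chain_last: "\<lbrakk>chain A S u q t; q \<noteq> []; t \<in> S\<rbrakk> \<Longrightarrow> (last q, t) \<in> A"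
  by (induction q arbitrary: u) auto

lemma leg_last: "\<lbrakk>leg A S u q t; t \<in> S\<rbrakk> \<Longrightarrow> (last (u # q), t) \<in> A"
  using chain_last[of A S u q t] by (auto simp: leg_def)

section \<open>An intersection node that is neither the root nor a party\<close>

context rooted_tree
begin

text \<open>After Step 4 the observed set is the path from \<open>a\<close> to \<open>r\<close>,
  with \<open>i\<close> and \<open>j\<close> hanging on \<open>a\<close> and \<open>k\<close>
  adjacent or equal to \<open>r\<close>. Step 5(c) carries \<open>i\<close> and \<open>j\<close>
  together towards the root.\<close>

lemma protocol_nonparty_inter_node:
  assumes V: "{i, j, k} \<subseteq> pverts T" and d: "distinct [i, j, k]"
    and a: "a \<in> pverts T" "a \<noteq> r" "a \<notin> {i, j, k}"
    and ij: "set (root_path i) \<inter> set (root_path j) = set (root_path a)"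
    and sep: "set (root_path i) \<inter> set (root_path k) = {r}" "set (root_path j) \<inter> set (root_path k) = {r}"
  defines "P \<equiv> {i, j, k}"
  shows "always (has_hub P) (step4 T r P T and_then step5 T r P and_then step6 r P)"
proof -
  have i: "i \<in> pverts T" and j: "j \<in> pverts T" and k: "k \<in> pverts T" and P: "P \<subseteq> pverts T" "P \<noteq> {}"
    using V by (auto simp: P_def)
  have ai: "a \<in> set (root_path i)" "a \<in> set (root_path j)" using ij self_in_root_path[OF a(1)] by auto
  have ir: "i \<noteq> r" "j \<noteq> r" using ai a(2) root_path_root by auto
  have ak: "set (root_path a) \<inter> set (root_path k) = {r}"
    using ij sep(1) root_in_root_path[OF a(1)] root_in_root_path[OF k] by auto
  have inter: "inter_node T r i j = a" "inter_node T r j i = a" "inter_node T r i k = r"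
    "inter_node T r k i = r" "inter_node T r j k = r" "inter_node T r k j = r"
    using ij sep i j k by (auto intro!: inter_node_eqI[OF _ _ a(1)] inter_node_rootI)
  have nodes: "inter_nodes T r P = {a, r}"
  proof
    show "inter_nodes T r P \<subseteq> {a, r}"
      using inter unfolding inter_nodes_def P_def by auto
    show "{a, r} \<subseteq> inter_nodes T r P"
      using inter(1,3) d unfolding inter_nodes_def P_def by force
  qed
  have near_i: "nearest_inter_node T r P i = a"
  proof -
    have "{inter_node T r i x |x. x \<in> P - {i}} - {i} = {a, r}"
      using inter(1,3) d ir a(3) unfolding P_def by force
    then show ?thesis
      unfolding nearest_inter_node_def using dist_less[OF i ai(1) a(2)] by (intro arg_min_on_eqI) auto
  qed
  have near_j: "nearest_inter_node T r P j = a"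
  proof -
    have "{inter_node T r j x |x. x \<in> P - {j}} - {j} = {a, r}"
      using inter(2,5) d ir a(3) unfolding P_def by force
    then show ?thesis
      unfolding nearest_inter_node_def using dist_less[OF j ai(2) a(2)] by (intro arg_min_on_eqI) auto
  qed
  have near_k: "nearest_inter_node T r P k = r" if "k \<noteq> r"
  proof -
    have "{inter_node T r k x |x. x \<in> P - {k}} - {k} = {r}"
      using inter(4,6) d that unfolding P_def by force
    then show ?thesis by (simp add: nearest_inter_node_def arg_min_on_singleton)
  qed
  let ?q = "inner_path a r"
  have sa: "root_path a = a # ?q @ [r]" "distinct (a # ?q @ [r])"
    using inner_path(2,3)[OF a(1) root_in_root_path[OF a(1)]] a(2) root_path_root by auto
  have si: "set (i # inner_path i a) \<inter> set (root_path a) = {}" "set (i # inner_path i a) \<subseteq> set (root_path i)"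
    using inner_path(4,5)[OF i ai(1)] a(3) by auto
  have sj: "set (j # inner_path j a) \<inter> set (root_path a) = {}" "set (j # inner_path j a) \<subseteq> set (root_path j)"
    using inner_path(4,5)[OF j ai(2)] a(3) by auto
  have sk: "set (k # inner_path k r) \<inter> set (root_path x) = {}"
    if "k \<noteq> r" "set (root_path x) \<inter> set (root_path k) = {r}" for x
    using disjoint_from_branch[OF k that(1), of x] that(2) by blast
  have rk: "r \<in> set (root_path a)" using root_in_root_path[OF a(1)] .
  have sik: "set (i # inner_path i a) \<inter> set (root_path k) = {}"
  proof -
    have "set (i # inner_path i a) \<inter> set (root_path k) \<subseteq> {r}" using si(2) sep(1) by blast
    then show ?thesis using si(1) rk by auto
  qed
  have sjk: "set (j # inner_path j a) \<inter> set (root_path k) = {}"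
  proof -
    have "set (j # inner_path j a) \<inter> set (root_path k) \<subseteq> {r}" using sj(2) sep(2) by blast
    then show ?thesis using sj(1) rk by auto
  qed
  let ?L = "insert k (set (root_path a))"
  have ijL: "i \<notin> ?L" "j \<notin> ?L" using si sj d by auto
  let ?t = "\<lambda>p. if p = k then r else a"
  let ?Q = "\<lambda>G. pair_graph G \<and> P \<subseteq> pverts G \<and> (i, j) \<notin> parcs G \<and>
    (\<forall>x\<in>?L. (i, x) \<in> parcs G \<longleftrightarrow> x = a) \<and> (\<forall>x\<in>?L. (j, x) \<in> parcs G \<longleftrightarrow> x = a) \<and>
    (k \<noteq> r \<longrightarrow> (\<forall>x\<in>?L. (k, x) \<in> parcs G \<longleftrightarrow> x = r)) \<and> leg (parcs G) ?L a ?q r"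
  have "always ?Q (step4 T r P T)"
  proof (rule always_step4)
    show "finite P" by (simp add: P_def)
    fix xs ys assume o: "distinct xs" "set xs = P - {r} - inter_nodes T r P"
      "distinct ys" "set ys = (P - {r}) \<inter> inter_nodes T r P"
    have "set ys = {}" using o(4) a(3) nodes unfolding P_def by auto
    then have ys: "ys = []" by simp
    have xs: "set xs = {i, j} \<union> ({k} - {r})" using o(2) a(3) ir nodes unfolding P_def by auto
    show "\<exists>G. measX_seq (concat (map (route T r P) (xs @ ys))) T = Some G \<and> ?Q G"
    proof (rule routes_tree[OF P o(1), of ?t])
      show "set xs \<subseteq> P" using xs unfolding P_def by auto
      show "nearest_inter_node T r P p = ?t p" if "p \<in> set xs" for p
        using that xs near_i near_j near_k d by auto
      show "?t p \<in> set (root_path p) \<and> ?t p \<noteq> p" if "p \<in> set xs" for p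
        using that xs ai a d root_in_root_path[OF k] by auto
      show "set (p # inner_path p (?t p)) \<inter> set (root_path p') = {}" if p: "p \<in> set xs" "p' \<in> P" "p' \<noteq> p" for p p'
      proof (cases "p = k")
        case True
        then have "k \<noteq> r" "p' = i \<or> p' = j" using p xs ir unfolding P_def by auto
        then show ?thesis using True sk[of i] sk[of j] sep by auto
      next
        case False
        then have "p = i \<or> p = j" "p' \<in> {i, j, k} - {p}" using p xs unfolding P_def by auto
        moreover have "set (i # inner_path i a) \<inter> set (root_path j) = {}" using si ij by blast
        moreover have "set (j # inner_path j a) \<inter> set (root_path i) = {}" using sj ij by blast
        moreover have "set (i # inner_path i a) \<inter> set (root_path k) = {}" "set (j # inner_path j a) \<inter> set (root_path k) = {}"
          by (rule sik, rule sjk)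
        ultimately show ?thesis using False by auto
      qed
      let ?S = "(\<Union>p\<in>P. set (root_path p)) - (\<Union>p\<in>set xs. set (inner_path p (?t p)))"
      fix G assume G: "measX_seq (concat (map (route T r P) xs)) T = Some G" "pair_graph G" "P \<subseteq> pverts G"
        "insert r P \<subseteq> ?S"
        "\<And>p x. \<lbrakk>p \<in> set xs; x \<in> ?S\<rbrakk> \<Longrightarrow> (p, x) \<in> parcs G \<longleftrightarrow> x = ?t p"
        "\<And>x y. \<lbrakk>x \<in> ?S - set xs; y \<in> ?S - set xs\<rbrakk> \<Longrightarrow> (x, y) \<in> parcs G \<longleftrightarrow> (x, y) \<in> parcs T"
      have paS: "set (root_path a) \<subseteq> ?S - set xs"
      proof
        fix x assume x: "x \<in> set (root_path a)"
        have "x \<notin> set (inner_path p (?t p)) \<and> x \<noteq> p" if "p \<in> set xs" for p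
          using that xs si(1) sj(1) sk[OF _ ak] x d by auto
        moreover have "x \<in> set (root_path i)" using x ij by blast
        ultimately show "x \<in> ?S - set xs" unfolding P_def by auto
      qed
      have jS: "j \<in> ?S" and LS: "?L \<subseteq> ?S" using paS G(4) unfolding P_def by auto
      have Gi: "(i, x) \<in> parcs G \<longleftrightarrow> x = a" if "x \<in> ?S" for x
        using G(5)[OF _ that, of i] xs d by simp
      have Gj: "(j, x) \<in> parcs G \<longleftrightarrow> x = a" if "x \<in> ?S" for x
        using G(5)[OF _ that, of j] xs d by simp
      have Gk: "(k, x) \<in> parcs G \<longleftrightarrow> x = r" if "k \<noteq> r" "x \<in> ?S" for x
        using G(5)[OF _ that(2), of k] xs that(1) by simp
      have same: "(x, y) \<in> parcs G \<longleftrightarrow> (x, y) \<in> parcs T" if "x \<in> set (root_path a)" "y \<in> set (root_path a)" for x y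
        by (rule G(6)[OF subsetD[OF paS that(1)] subsetD[OF paS that(2)]])
      have GL: "x \<in> ?L \<Longrightarrow> (i, x) \<in> parcs G \<longleftrightarrow> x = a" "x \<in> ?L \<Longrightarrow> (j, x) \<in> parcs G \<longleftrightarrow> x = a"
        "k \<noteq> r \<Longrightarrow> x \<in> ?L \<Longrightarrow> (k, x) \<in> parcs G \<longleftrightarrow> x = r" for x
        by (rule Gi, erule subsetD[OF LS], rule Gj, erule subsetD[OF LS], rule Gk, assumption, erule subsetD[OF LS])
      have "leg (parcs G) ?L a ?q r"
        by (rule leg_cong_tree[OF a(1,2) k ak G(2) same]) (simp_all add: GL(3))
      moreover have "(i, j) \<notin> parcs G" using Gi[OF jS] a(3) by auto
      moreover have "\<forall>x\<in>?L. (i, x) \<in> parcs G \<longleftrightarrow> x = a" "\<forall>x\<in>?L. (j, x) \<in> parcs G \<longleftrightarrow> x = a"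
        "k \<noteq> r \<longrightarrow> (\<forall>x\<in>?L. (k, x) \<in> parcs G \<longleftrightarrow> x = r)"
        using GL by simp_all
      moreover have "measX_seq (concat (map (route T r P) (xs @ ys))) T = Some G"
        using G(1) ys by simp
      ultimately show ?thesis using G(2,3) by (intro exI[of _ G] conjI)
    qed
  qed
  \<comment> \<open>The branches of Step 5(c) end in different shapes, a star, a path, or a hub
    already in place. The intermediate assertion is therefore success of Step 6 itself and not a
    description of the graph.\<close>
  then have "always (\<lambda>G. always (has_hub P) (step6 r P G)) (step4 T r P T and_then step5 T r P)"
  proof (rule always_and_then)
    fix G assume "?Q G"
    then have G: "pair_graph G" "P \<subseteq> pverts G" and nij: "(i, j) \<notin> parcs G"
      and Ni: "\<And>x. x \<in> ?L \<Longrightarrow> (i, x) \<in> parcs G \<longleftrightarrow> x = a"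
      and Nj: "\<And>x. x \<in> ?L \<Longrightarrow> (j, x) \<in> parcs G \<longleftrightarrow> x = a"
      and Nk: "\<And>x. \<lbrakk>k \<noteq> r; x \<in> ?L\<rbrakk> \<Longrightarrow> (k, x) \<in> parcs G \<longleftrightarrow> x = r"
      and leg: "leg (parcs G) ?L a ?q r"
      by blast+
    \<comment> \<open>The path has \<open>m = length ?q + 2\<close> vertices, so \<open>m\<close> is
      even exactly if \<open>?q\<close> has even length; then \<open>i\<close> and \<open>j\<close>
      stop at vertex number \<open>m - 1\<close>, and one more measurement is due.\<close>
    let ?h = "if even (length ?q) then last (a # ?q) else r"
    have "\<exists>G'. measX_seq (hops (a # ?q @ [r])) G = Some G' \<and> pair_graph G' \<and>
      pverts G - set ?q \<subseteq> pverts G' \<and>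
      (\<forall>x\<in>insert ?h (?L - set (a # ?q)). \<forall>y\<in>insert ?h (?L - set (a # ?q)). (x, y) \<in> parcs G' \<longleftrightarrow> (x, y) \<in> parcs G) \<and>
      (\<forall>x\<in>{i, j}. \<forall>y\<in>{i, j}. (x, y) \<in> parcs G' \<longleftrightarrow> (x, y) \<in> parcs G) \<and>
      (\<forall>j\<in>{i, j}. \<forall>x\<in>insert ?h (?L - set (a # ?q)). (j, x) \<in> parcs G' \<longleftrightarrow> x = ?h)"
    proof (rule hops_leg[OF G(1) leg sa(2)])
      show "set (a # ?q @ [r]) \<subseteq> ?L" using sa(1) by auto
      show "{i, j} \<inter> ?L = {}" using ijL by simp
      show "(j', x) \<in> parcs G \<longleftrightarrow> x = a" if "j' \<in> {i, j}" "x \<in> ?L" for j' x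
        using Ni[OF that(2)] Nj[OF that(2)] that(1) by blast
    qed
    then obtain G' where G': "measX_seq (hops (a # ?q @ [r])) G = Some G'" "pair_graph G'"
      "pverts G - set ?q \<subseteq> pverts G'"
      "\<forall>x\<in>insert ?h (?L - set (a # ?q)). \<forall>y\<in>insert ?h (?L - set (a # ?q)). (x, y) \<in> parcs G' \<longleftrightarrow> (x, y) \<in> parcs G"
      "\<forall>x\<in>{i, j}. \<forall>y\<in>{i, j}. (x, y) \<in> parcs G' \<longleftrightarrow> (x, y) \<in> parcs G"
      "\<forall>j\<in>{i, j}. \<forall>x\<in>insert ?h (?L - set (a # ?q)). (j, x) \<in> parcs G' \<longleftrightarrow> x = ?h"
      by (elim exE conjE)
    have kq: "k \<notin> set (a # ?q)"
      using disjoint_from_branch[OF a(1,2) ak] self_in_root_path[OF k] by blast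
    have hkr: "{?h, k, r} \<subseteq> insert ?h (?L - set (a # ?q))" using kq sa by auto
    have P': "P \<subseteq> pverts G'"
    proof -
      have "i \<notin> set ?q" "j \<notin> set ?q" "k \<notin> set ?q" using ijL sa(1) kq by auto
      then show ?thesis using G(2) G'(3) unfolding P_def by auto
    qed
    have nij': "(i, j) \<notin> parcs G'" using G'(5) nij by simp
    have Ni': "(i, x) \<in> parcs G' \<longleftrightarrow> x = ?h" and Nj': "(j, x) \<in> parcs G' \<longleftrightarrow> x = ?h"
      if "x \<in> {?h, k, r}" for x
      using bspec[OF bspec[OF G'(6), of i] subsetD[OF hkr that]]
        bspec[OF bspec[OF G'(6), of j] subsetD[OF hkr that]] by simp_all
    have same: "(x, y) \<in> parcs G' \<longleftrightarrow> (x, y) \<in> parcs G" if "x \<in> {?h, k, r}" "y \<in> {?h, k, r}" for x y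
      using bspec[OF bspec[OF G'(4) subsetD[OF hkr that(1)]] subsetD[OF hkr that(2)]] .
    have step5: "step5 T r P G = step5c T r P a G"
    proof -
      have "{a' \<in> {a, r}. a' \<noteq> r \<and> a' \<notin> P} = {a}" "\<not> (\<exists>a'\<in>{a, r}. a' \<noteq> r \<and> a' \<in> P)"
        using a(2,3) unfolding P_def by auto
      then show ?thesis
        unfolding step5_def nodes using a(2) by (simp add: choose_from_def)
    qed
    \<comment> \<open>Vertex number \<open>m - 1\<close> is entry \<open>m - 2\<close> of the list,
      and \<open>m - 2 = length ?q\<close>.\<close>
    have last: "last (a # ?q) = (a # ?q @ [r]) ! length ?q"
      by (metis append_Cons butlast.simps(2) butlast_snoc last_conv_nth length_Cons diff_Suc_1 list.distinct(1) nth_append lessI)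
    have path: "tree_path T a r = a # ?q @ [r]" using sa(1) by (simp add: root_path_def)
    show "always (\<lambda>G. always (has_hub P) (step6 r P G)) (step5 T r P G)"
    proof (cases "even (length ?q)")
      case False
      then have "step5c T r P a G = {Some G'}"
        unfolding step5c_def path Let_def hops_conv_nth using G'(1) by simp
      moreover have "always (has_hub P) (step6 r P G')"
      proof (rule step6_star[OF G'(2) P' P(2)])
        fix p x assume p: "p \<in> P" "p \<noteq> r" "x \<in> insert r P"
        have r: "(i, x) \<in> parcs G' \<longleftrightarrow> x = r" "(j, x) \<in> parcs G' \<longleftrightarrow> x = r" if "x \<in> {k, r}" for x
          using Ni'[of x] Nj'[of x] False that by auto
        have "(k, r) \<in> parcs G'" if "k \<noteq> r"
          using same[of k r] Nk[OF that, of r] rk by simp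
        then show "(p, x) \<in> parcs G' \<longleftrightarrow> x = r"
          using p r nij' ir d pair_graph_sym[OF G'(2), of j i] pair_graph_sym[OF G'(2), of k i]
            pair_graph_sym[OF G'(2), of k j] pair_graph_irrefl[OF G'(2)] unfolding P_def by auto
      qed
      ultimately show ?thesis unfolding step5 by (simp only: always_single) blast
    next
      case True
      let ?l = "last (a # ?q)"
      have c: "step5c T r P a G = choose_from {i \<in> P. i \<in> nbhd G a}
          (\<lambda>i. {measX_seq (hops (a # ?q @ [r]) @ [(?l, i)]) G})"
        unfolding step5c_def path Let_def hops_conv_nth last using True by simp
      have seqs: "measX_seq (hops (a # ?q @ [r]) @ [(?l, x)]) G = measX ?l x G'" for x
        using G'(1) by (simp add: measX_seq_append split: bind_splits)
      have lq: "?l \<in> set (a # ?q)" by (rule last_in_set) simp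
      have lne: "?l \<notin> {i, j, k, r}" using lq kq sa ijL by auto
      have lr: "(?l, r) \<in> parcs G"
        using leg_last[OF leg] rk by simp
      have lk: "(?l, k) \<notin> parcs G" if "k \<noteq> r"
        using Nk[OF that, of ?l] lq sa lne pair_graph_sym[OF G(1), of k ?l] by auto
      show ?thesis
        unfolding step5 c
      proof (rule always_choose)
        have "(a, i) \<in> parcs G" using Ni[of a] pair_graph_sym[OF G(1), of a i] self_in_root_path[OF a(1)] by simp
        then show "{i \<in> P. i \<in> nbhd G a} \<noteq> {}" unfolding P_def nbhd_def by auto
      next
        fix x assume x: "x \<in> {i \<in> P. i \<in> nbhd G a}"
        have kr: "(l, r) \<in> parcs G' \<and> (k \<noteq> r \<longrightarrow> (l, k) \<notin> parcs G' \<and> (k, r) \<in> parcs G')" if "l = ?l" for l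
          using that True same[of ?l r] same[of ?l k] same[of k r] lr lk Nk[of r] rk by simp
        have N: "(i, ?l) \<in> parcs G'" "(j, ?l) \<in> parcs G'" "(i, r) \<notin> parcs G'" "(j, r) \<notin> parcs G'"
          "k \<noteq> r \<Longrightarrow> (i, k) \<notin> parcs G'" "k \<noteq> r \<Longrightarrow> (j, k) \<notin> parcs G'"
          using Ni'[of ?l] Nj'[of ?l] Ni'[of r] Nj'[of r] Ni'[of k] Nj'[of k] True lne by auto
        have "\<exists>G2. measX ?l x G' = Some G2 \<and> always (has_hub P) (step6 r P G2)"
        proof -
          have "x = i \<or> x = j \<or> x = k" using x by (simp add: P_def)
          moreover have ?thesis if xi: "x = i"
            unfolding xi P_def
            by (rule step6_after_measX[OF G'(2)]) (use P' N kr[OF refl] nij' lne d ir lq kq in \<open>auto simp: P_def\<close>)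
          moreover have ?thesis if xj: "x = j"
          proof -
            have nji: "(j, i) \<notin> parcs G'" using nij' pair_graph_sym[OF G'(2)] by blast
            have "\<exists>G2. measX ?l j G' = Some G2 \<and> always (has_hub {j, i, k}) (step6 r {j, i, k} G2)"
              by (rule step6_after_measX[OF G'(2)]) (use P' N kr[OF refl] nji lne d ir lq kq in \<open>auto simp: P_def\<close>)
            then show ?thesis unfolding xj P_def by (simp only: insert_commute)
          qed
          \<comment> \<open>\<open>k\<close> is eligible as a basis only if it is the root and
            adjacent to \<open>a\<close>. The measurement then hands \<open>i\<close> and
            \<open>j\<close> over to \<open>r\<close>, which is a party and the hub, and Step 6 is
            idle.\<close>
          moreover have ?thesis if xk: "x = k"
          proof -
            have "(k, a) \<in> parcs G" using x xk pair_graph_sym[OF G(1)] by (simp add: nbhd_def)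
            then have "k = r" using Nk[of a] a(2) self_in_root_path[OF a(1)] by auto
            have "(?l, r) \<in> parcs G'" using kr by blast
            from G'(2) this obtain G2 where G2: "measX ?l r G' = Some G2" "pair_graph G2" "pverts G2 = pverts G' - {?l}"
              "\<And>y. \<lbrakk>y \<noteq> ?l; y \<noteq> r\<rbrakk> \<Longrightarrow> (r, y) \<in> parcs G2 \<longleftrightarrow> (?l, y) \<in> parcs G'"
              by (rule measX) blast
            have "(r, i) \<in> parcs G2" "(r, j) \<in> parcs G2"
              using G2(4)[of i] G2(4)[of j] N(1,2) lne ir pair_graph_sym[OF G'(2)] by auto
            then have "\<forall>y\<in>P - {r}. (r, y) \<in> parcs G2" using \<open>k = r\<close> unfolding P_def by blast
            moreover have "?l \<notin> P" using lne unfolding P_def by blast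
            then have "P \<subseteq> pverts G2" using P' G2(3) by blast
            moreover have "r \<in> P" using \<open>k = r\<close> unfolding P_def by simp
            ultimately have "has_hub P G2" using G2(2) unfolding has_hub_def by blast
            with \<open>r \<in> P\<close> show ?thesis using G2(1) xk \<open>k = r\<close> by (simp add: step6_def always_SomeI)
          qed
          ultimately show ?thesis by blast
        qed
        then show "always (\<lambda>G. always (has_hub P) (step6 r P G)) {measX_seq (hops (a # ?q @ [r]) @ [(?l, x)]) G}"
          unfolding seqs always_single .
      qed
    qed
  qed
  then show ?thesis by (rule always_and_then)
qed

section \<open>Two and three parties\<close>

lemma protocol_two_branches:
  assumes V: "{i, j, k} \<subseteq> pverts T" and d: "distinct [i, j, k]"
    and sep: "set (root_path i) \<inter> set (root_path k) = {r}" "set (root_path j) \<inter> set (root_path k) = {r}"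
  shows "always (has_hub {i, j, k})
    (step4 T r {i, j, k} T and_then step5 T r {i, j, k} and_then step6 r {i, j, k})"
proof -
  obtain a where a: "a \<in> pverts T" and ij: "set (root_path i) \<inter> set (root_path j) = set (root_path a)"
    using ex_inter_node[of i j] V by auto
  have ai: "a \<in> set (root_path i)" "a \<in> set (root_path j)" using ij self_in_root_path[OF a] by auto
  show ?thesis
  proof (cases "a = r")
    case True
    have "set (root_path x) \<inter> set (root_path y) = {r}" if "x \<in> {i, j, k}" "y \<in> {i, j, k}" "x \<noteq> y" for x y
      using that ij sep True root_path_root by (auto simp: Int_commute)
    then show ?thesis using V d by (intro protocol_star[of _ i j]) auto
  next
    case False
    \<comment> \<open>Otherwise \<open>k\<close> would lie on the root path of \<open>i\<close> and
      would have to be the root, which \<open>a\<close> is not.\<close>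
    have "a \<noteq> k"
      using ai(1) sep(1) False V self_in_root_path[of k] by auto
    then consider "a = j" | "a = i" | "a \<notin> {i, j, k}" by auto
    then show ?thesis
    proof cases
      case 1
      then show ?thesis using V d ai False sep by (intro protocol_party_inter_node) auto
    next
      case 2
      have "{j, i, k} \<subseteq> pverts T" "distinct [j, i, k]" "i \<noteq> r" "i \<in> set (root_path j)"
        using V d ai False 2 by auto
      from protocol_party_inter_node[OF this sep(2,1)] show ?thesis by (simp only: insert_commute)
    next
      case 3
      then show ?thesis using protocol_nonparty_inter_node[OF V d a False _ ij sep] by simp
    qed
  qed
qed

text \<open>The two intersection nodes on the root path of \<open>i\<close> are comparable. The one
  closer to the root lies on all three root paths, so it is \<open>r\<close>.\<close>

lemma branch_at_root:
  assumes V: "{i, j, k} \<subseteq> pverts T" and r: "set (root_path i) \<inter> set (root_path j) \<inter> set (root_path k) = {r}"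
  shows "set (root_path i) \<inter> set (root_path j) = {r} \<or> set (root_path i) \<inter> set (root_path k) = {r}"
proof -
  obtain b where b: "b \<in> pverts T" "set (root_path i) \<inter> set (root_path j) = set (root_path b)"
    using ex_inter_node[of i j] V by auto
  obtain c where c: "c \<in> pverts T" "set (root_path i) \<inter> set (root_path k) = set (root_path c)"
    using ex_inter_node[of i k] V by auto
  have "b \<in> set (root_path i)" "c \<in> set (root_path i)" using b c self_in_root_path by blast+
  then have "b \<in> set (root_path c) \<or> c \<in> set (root_path b)" using root_path_chain[of i b c] V by simp
  then have "b = r \<or> c = r" using b c r self_in_root_path by blast
  then show ?thesis using b c root_path_root by auto
qed

lemma protocol_has_hub:
  assumes P: "P \<subseteq> pverts T" "2 \<le> card P" "card P \<le> 3" and r: "(\<Inter>p\<in>P. set (root_path p)) = {r}"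
  shows "always (has_hub P) (step4 T r P T and_then step5 T r P and_then step6 r P)"
proof (cases "card P = 2")
  case True
  then obtain i j where "P = {i, j}" "i \<noteq> j" by (auto simp: card_2_iff)
  with P r show ?thesis by (intro protocol_star[of _ i j]) (auto simp: Int_commute)
next
  case False
  then have "card P = 3" using P by simp
  then obtain i j k where ijk: "P = {i, j, k}" "i \<noteq> j" "j \<noteq> k" "i \<noteq> k" by (auto simp: card_3_iff)
  have V: "{i, j, k} \<subseteq> pverts T" "{j, i, k} \<subseteq> pverts T" "{k, i, j} \<subseteq> pverts T" using P ijk by auto
  have r': "set (root_path i) \<inter> set (root_path j) \<inter> set (root_path k) = {r}" "set (root_path j) \<inter> set (root_path i) \<inter> set (root_path k) = {r}"
    "set (root_path k) \<inter> set (root_path i) \<inter> set (root_path j) = {r}"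
    using r ijk by auto
  have c: "set (root_path j) \<inter> set (root_path i) = set (root_path i) \<inter> set (root_path j)" "set (root_path k) \<inter> set (root_path i) = set (root_path i) \<inter> set (root_path k)"
    "set (root_path k) \<inter> set (root_path j) = set (root_path j) \<inter> set (root_path k)" by auto
  \<comment> \<open>Any two of the three pairs share a party, and \<open>branch_at_root\<close> at
    this party makes one of the two meet in \<open>r\<close> only. So at most one pair fails; the
    party outside it takes the last place in \<open>protocol_two_branches\<close>.\<close>
  consider "set (root_path i) \<inter> set (root_path k) = {r}" "set (root_path j) \<inter> set (root_path k) = {r}"
    | "set (root_path i) \<inter> set (root_path j) = {r}" "set (root_path k) \<inter> set (root_path j) = {r}"
    | "set (root_path j) \<inter> set (root_path i) = {r}" "set (root_path k) \<inter> set (root_path i) = {r}"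
    using branch_at_root[OF V(1) r'(1)] branch_at_root[OF V(2) r'(2)] branch_at_root[OF V(3) r'(3)]
    unfolding c by blast
  then show ?thesis
  proof cases
    case 1
    then show ?thesis using protocol_two_branches[of i j k] V ijk by simp
  next
    case 2
    have "P = {i, k, j}" using ijk by auto
    then show ?thesis using protocol_two_branches[of i k j] 2 V ijk by simp
  next
    case 3
    have "P = {j, k, i}" using ijk by auto
    then show ?thesis using protocol_two_branches[of j k i] 3 V ijk by simp
  qed
qed

end

theorem theorem2:
  fixes T :: "'a pair_pre_digraph" and r :: 'a and P :: "'a set" and n :: nat
  assumes "undirected_tree T"
    and "r \<in> pverts T"
    and "P \<subseteq> pverts T"
    and "card P = n" and "2 \<le> n" and "n \<le> 3"
  shows "dodag_x T r P \<noteq> {} \<and>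
    (\<forall>R \<in> dodag_x T r P. \<exists>G. R = Some G \<and> entangled_exactly G P)"
proof -
  interpret utree T using assms(1) by unfold_locales
  let ?r = "new_root T r P"
  have "P \<noteq> {}" using assms(4,5) by auto
  note r = new_root[OF assms(2,3) this]
  interpret rooted_tree T ?r using r(1) by unfold_locales
  have "always (has_hub P) (step4 T ?r P T and_then step5 T ?r P and_then step6 ?r P)"
    using protocol_has_hub[of P] r(2) assms(3-6) by (simp add: root_path_def)
  then have "always (\<lambda>G. entangled_exactly G P) (dodag_x T r P)"
    unfolding dodag_x_def Let_def by (rule always_and_then) (rule step7_has_hub)
  then show ?thesis by (simp add: always_def)
qed

end
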